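(* Let $\mathbf W=(G,m)$ be a finite weighted graph, and let $v_0$ be a centre vertex of $G$ with cycle edges $A(v_0)$. Put \[ \delta:=\rho(v_0)-\sum_{e\in A(v_0)}\frac{m_e}{m((v_0)_e)}-\frac{m(A(v_0))}{m(v_0)}. \] Then the Lebesgue measure of the magnetic spectral gaps set $\mathcal{MS}^{\mathbf W}$ is at least $\delta$. In particular, if $\delta>0$ then $\mathcal{MS}^{\mathbf W}\neq\emptyset$.
   Context: A graph $G=(V,E,\partial)$ has orientation $\partial e=(\partial_-e,\partial_+e)$; loops and multiple edges allowed. $E_v$ is the disjoint union of $\{e:\partial_+e=v\}$ and $\{e:\partial_-e=v\}$ (a loop counts twice). A weight $m$: $m:V\to(0,\infty)$, $m:E\to(0,\infty)$; for $F\subset E$, $m(F)=\sum_{e\in F}m_e$; relative weight $\rho(v)=m(E_v)/m(v)$ (loops counted twice), $\rho_\infty=\max_v\rho(v)$. For an edge $e$ incident to $v$, $v_e$ denotes the other endpoint of $e$ ($v_e=v$ for a loop). A vector potential is $\alpha:E\to\mathbb R/2\pi\mathbb Z$; $\mathcal A(G)$ is the set of all vector potentials. $(d_\alpha f)_e=e^{i\alpha_e/2}f(\partial_+e)-e^{-i\alpha_e/2}f(\partial_-e)$ from $\ell_2(V,m)$ (inner product $\sum f\bar g\,m(v)$) to $\ell_2(E,m)$ (inner product $\sum\eta\bar\zeta\,m_e$), and $\Delta^{\mathbf W}_\alpha=d_\alpha^*d_\alpha$. The magnetic spectral gaps set is $\mathcal{MS}^{\mathbf W}=[0,2\rho_\infty]\setminus\bigcup_{\alpha\in\mathcal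 A(G)}\sigma(\Delta^{\mathbf W}_\alpha)$. A vertex $v_0$ is a centre vertex if there is a set $A(v_0)\subset E_{v_0}$ of edges incident to $v_0$ (the cycle edges) such that the graph with vertex set $V$ and edge set $E\setminus A(v_0)$ is a tree (connected and without cycles). *)

theory Defs
  imports "HOL-Analysis.Analysis" "Graph_Theory.Digraph_Component"
begin

text \<open>
  An oriented multigraph $G=(V,E,\partial)$ is a \<^typ>\<open>('v, 'e) pre_digraph\<close>, with
  \<^const>\<open>tail\<close> and \<^const>\<open>head\<close> for $\partial_-$ and $\partial_+$.  Loops and multiple edges
  are allowed.
\<close>

locale finite_weighted_graph = fin_digraph G
  for G :: "('v, 'e) pre_digraph" (structure) +
  fixes mV :: "'v \<Rightarrow> real" and mE :: "'e \<Rightarrow> real"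
  assumes mV_pos: "v \<in> verts G \<Longrightarrow> 0 < mV v"
    and mE_pos: "e \<in> arcs G \<Longrightarrow> 0 < mE e"

definition other_end :: "('v, 'e) pre_digraph \<Rightarrow> 'v \<Rightarrow> 'e \<Rightarrow> 'v" where
  "other_end G v e = (if tail G e = v then head G e else tail G e)"

text \<open>The two sums run over the two parts of the disjoint union $E_v$, so a loop counts twice.\<close>

definition rel_weight :: "('v, 'e) pre_digraph \<Rightarrow> ('v \<Rightarrow> real) \<Rightarrow> ('e \<Rightarrow> real) \<Rightarrow> 'v \<Rightarrow> real" where
  "rel_weight G mV mE v = (sum mE (in_arcs G v) + sum mE (out_arcs G v)) / mV v"

definition max_rel_weight :: "('v, 'e) pre_digraph \<Rightarrow> ('v \<Rightarrow> real) \<Rightarrow> ('e \<Rightarrow> real) \<Rightarrow> real" where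
  "max_rel_weight G mV mE = Max (rel_weight G mV mE ` verts G)"


section \<open>Trees and centre vertices\<close>

text \<open>
  The cycles of the library are directed ones, so its \<^const>\<open>forest\<close> and \<^const>\<open>tree\<close>
  do not describe the underlying undirected multigraph.  Below, the $i$-th edge of a cycle joins the
  $i$-th vertex to the next one, in either direction.  Loops (length 1) and pairs of parallel edges
  (length 2) are cycles.
\<close>

definition undirected_cycle :: "('v, 'e) pre_digraph \<Rightarrow> 'v list \<Rightarrow> 'e list \<Rightarrow> bool" where
  "undirected_cycle G vs es \<longleftrightarrow>
     es \<noteq> [] \<and> length vs = length es \<and> distinct vs \<and> distinct es \<and> set es \<subseteq> arcs G \<and>
     (\<forall>i < length es. {tail G (es ! i), head G (es ! i)} = {vs ! i, vs ! (Suc i mod length es)})"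

text \<open>Connectedness in the library already ignores the orientation.\<close>

definition undirected_tree :: "('v, 'e) pre_digraph \<Rightarrow> bool" where
  "undirected_tree G \<longleftrightarrow> Digraph_Component.connected G \<and> (\<nexists>vs es. undirected_cycle G vs es)"

definition centre_vertex_with :: "('v, 'e) pre_digraph \<Rightarrow> 'v \<Rightarrow> 'e set \<Rightarrow> bool" where
  "centre_vertex_with G v0 A \<longleftrightarrow>
     v0 \<in> verts G \<and> A \<subseteq> in_arcs G v0 \<union> out_arcs G v0 \<and>
     undirected_tree (G\<lparr>arcs := arcs G - A\<rparr>)"


section \<open>The discrete magnetic Laplacian\<close>

text \<open>Functions on a finite set \<open>X\<close> are represented by their extension by zero.\<close>

definition ell2 :: "'x set \<Rightarrow> ('x \<Rightarrow> complex) set" where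
  "ell2 X = {f. \<forall>x. x \<notin> X \<longrightarrow> f x = 0}"

definition ell2_inner :: "'x set \<Rightarrow> ('x \<Rightarrow> real) \<Rightarrow> ('x \<Rightarrow> complex) \<Rightarrow> ('x \<Rightarrow> complex) \<Rightarrow> complex" where
  "ell2_inner X m f g = (\<Sum>x\<in>X. f x * cnj (g x) * complex_of_real (m x))"

definition ell2_adjoint ::
  "'x set \<Rightarrow> ('x \<Rightarrow> real) \<Rightarrow> 'y set \<Rightarrow> ('y \<Rightarrow> real) \<Rightarrow>
   (('x \<Rightarrow> complex) \<Rightarrow> 'y \<Rightarrow> complex) \<Rightarrow> ('y \<Rightarrow> complex) \<Rightarrow> 'x \<Rightarrow> complex" where
  "ell2_adjoint X mX Y mY T g =
     (THE h. h \<in> ell2 X \<and> (\<forall>f \<in> ell2 X. ell2_inner Y mY (T f) g = ell2_inner X mX f h))"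

text \<open>
  A vector potential with values in $\mathbb{R}/2\pi\mathbb{Z}$ is given by a real representative.
  The half-angle makes \<open>magnetic_d\<close> depend on the representative through a sign on each edge;
  \<open>magnetic_laplacian_cong\<close> shows that the Laplacian does not depend on it.
\<close>

definition magnetic_d ::
  "('v, 'e) pre_digraph \<Rightarrow> ('e \<Rightarrow> real) \<Rightarrow> ('v \<Rightarrow> complex) \<Rightarrow> 'e \<Rightarrow> complex" where
  "magnetic_d G \<alpha> f = (\<lambda>e. if e \<in> arcs G
     then exp (\<i> * complex_of_real (\<alpha> e) / 2) * f (head G e)
        - exp (- \<i> * complex_of_real (\<alpha> e) / 2) * f (tail G e)
     else 0)"

definition magnetic_laplacian ::
  "('v, 'e) pre_digraph \<Rightarrow> ('v \<Rightarrow> real) \<Rightarrow> ('e \<Rightarrow> real) \<Rightarrow> ('e \<Rightarrow> real) \<Rightarrow>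
   ('v \<Rightarrow> complex) \<Rightarrow> 'v \<Rightarrow> complex" where
  "magnetic_laplacian G mV mE \<alpha> f =
     ell2_adjoint (verts G) mV (arcs G) mE (magnetic_d G \<alpha>) (magnetic_d G \<alpha> f)"

text \<open>On a finite-dimensional space \<open>H\<close> the resolvent, if it exists, is automatically bounded.\<close>

definition op_spectrum :: "('x \<Rightarrow> complex) set \<Rightarrow> (('x \<Rightarrow> complex) \<Rightarrow> 'x \<Rightarrow> complex) \<Rightarrow> complex set" where
  "op_spectrum H T = {z. \<not> bij_betw (\<lambda>f x. T f x - z * f x) H H}"

definition magnetic_spectral_gaps ::
  "('v, 'e) pre_digraph \<Rightarrow> ('v \<Rightarrow> real) \<Rightarrow> ('e \<Rightarrow> real) \<Rightarrow> real set" where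
  "magnetic_spectral_gaps G mV mE =
     {0 .. 2 * max_rel_weight G mV mE} -
     (\<Union>\<alpha>. complex_of_real -` op_spectrum (ell2 (verts G)) (magnetic_laplacian G mV mE \<alpha>))"

lemma magnetic_d_shift:
  assumes "\<alpha> e - \<beta> e = 2 * pi * of_int k"
  shows "magnetic_d G \<alpha> f e = (- 1) powi k * magnetic_d G \<beta> f e"
proof -
  have a: "complex_of_real (\<alpha> e) = complex_of_real (\<beta> e) + 2 * complex_of_real (pi * of_int k)"
    using arg_cong[OF assms, of complex_of_real] by (simp add: algebra_simps)
  have p: "exp (\<i> * complex_of_real (pi * of_int k)) = (- 1) powi k"
  proof -
    have "exp (of_int k * (\<i> * complex_of_real pi)) = exp (\<i> * complex_of_real pi) powi k"
      by (rule exp_power_int[symmetric])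
    then show ?thesis by (simp add: mult_ac)
  qed
  have n: "exp (- (\<i> * complex_of_real (pi * of_int k))) = (- 1) powi k"
    unfolding exp_minus p by (simp add: power_int_minus[symmetric] power_int_minus_one_minus)
  have h1: "exp (\<i> * complex_of_real (\<alpha> e) / 2) = (- 1) powi k * exp (\<i> * complex_of_real (\<beta> e) / 2)"
    unfolding a p[symmetric] exp_add[symmetric] by (simp add: algebra_simps add_divide_distrib)
  have h2: "exp (- \<i> * complex_of_real (\<alpha> e) / 2) = (- 1) powi k * exp (- \<i> * complex_of_real (\<beta> e) / 2)"
    unfolding a n[symmetric] exp_add[symmetric]
    by (rule arg_cong[of _ _ exp]) (simp add: field_simps)
  show ?thesis
    unfolding magnetic_d_def h1 h2 by (simp add: algebra_simps)
qed

lemma magnetic_laplacian_cong: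
  assumes "\<And>e. e \<in> arcs G \<Longrightarrow> \<exists>k::int. \<alpha> e - \<beta> e = 2 * pi * of_int k"
  shows "magnetic_laplacian G mV mE \<alpha> = magnetic_laplacian G mV mE \<beta>"
proof -
  have "magnetic_d G \<alpha> f e * cnj (magnetic_d G \<alpha> g e) = magnetic_d G \<beta> f e * cnj (magnetic_d G \<beta> g e)"
    if e: "e \<in> arcs G" for f g e
  proof -
    obtain k :: int where k: "\<alpha> e - \<beta> e = 2 * pi * of_int k"
      using assms e by blast
    have "(- 1) powi k = (1 :: complex) \<or> (- 1) powi k = (- 1 :: complex)"
      by (cases "even k") auto
    then show ?thesis
      unfolding magnetic_d_shift[of \<alpha> e \<beta> k, OF k] by auto
  qed
  then have "ell2_inner (arcs G) mE (magnetic_d G \<alpha> f) (magnetic_d G \<alpha> g) =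
        ell2_inner (arcs G) mE (magnetic_d G \<beta> f) (magnetic_d G \<beta> g)" for f g
    unfolding ell2_inner_def by (intro sum.cong) auto
  then show ?thesis
    by (intro ext) (simp add: magnetic_laplacian_def ell2_adjoint_def)
qed

lemma ell2_inner_left_cancel:
  assumes "finite X" "\<And>x. x \<in> X \<Longrightarrow> 0 < m x" "g \<in> ell2 X" "h \<in> ell2 X"
    and eq: "\<And>f. f \<in> ell2 X \<Longrightarrow> ell2_inner X m f g = ell2_inner X m f h"
  shows "g = h"
proof
  fix x
  show "g x = h x"
  proof (cases "x \<in> X")
    case True
    let ?f = "\<lambda>y. if y = x then 1 else 0 :: complex"
    have val: "ell2_inner X m ?f u = cnj (u x) * complex_of_real (m x)" for u
    proof -
      have "ell2_inner X m ?f u = (\<Sum>y\<in>X. if y = x then cnj (u y) * complex_of_real (m y) else 0)"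
        unfolding ell2_inner_def by (intro sum.cong) auto
      then show ?thesis using \<open>finite X\<close> True by simp
    qed
    have "?f \<in> ell2 X"
      using True by (auto simp: ell2_def)
    from eq[OF this] show ?thesis
      using assms(2)[OF True] by (simp add: val)
  next
    case False
    then show ?thesis using assms by (simp add: ell2_def)
  qed
qed

context finite_weighted_graph
begin

text \<open>The adjoint $d_\alpha^*$ exists, and has the usual explicit form.\<close>

lemma magnetic_d_adjoint:
  "ell2_adjoint (verts G) mV (arcs G) mE (magnetic_d G \<alpha>) \<eta> =
     (\<lambda>v. if v \<in> verts G
       then ((\<Sum>e\<in>in_arcs G v. complex_of_real (mE e) * exp (- \<i> * complex_of_real (\<alpha> e) / 2) * \<eta> e)
           - (\<Sum>e\<in>out_arcs G v. complex_of_real (mE e) * exp (\<i> * complex_of_real (\<alpha> e) / 2) * \<eta> e))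
         / complex_of_real (mV v)
       else 0)"
  (is "_ = ?h")
  unfolding ell2_adjoint_def
proof (rule the_equality)
  have mem: "?h \<in> ell2 (verts G)"
    by (simp add: ell2_def)
  have adj: "ell2_inner (arcs G) mE (magnetic_d G \<alpha> f) \<eta> = ell2_inner (verts G) mV f ?h" for f
  proof -
    let ?p = "\<lambda>e. exp (\<i> * complex_of_real (\<alpha> e) / 2) * cnj (\<eta> e) * complex_of_real (mE e)"
    let ?n = "\<lambda>e. exp (- \<i> * complex_of_real (\<alpha> e) / 2) * cnj (\<eta> e) * complex_of_real (mE e)"
    have "ell2_inner (arcs G) mE (magnetic_d G \<alpha> f) \<eta> =
        (\<Sum>e\<in>arcs G. f (head G e) * ?p e) - (\<Sum>e\<in>arcs G. f (tail G e) * ?n e)"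
      unfolding ell2_inner_def magnetic_d_def sum_subtractf[symmetric]
      by (intro sum.cong) (auto simp: algebra_simps)
    also have "(\<Sum>e\<in>arcs G. f (head G e) * ?p e) = (\<Sum>v\<in>verts G. \<Sum>e\<in>in_arcs G v. f (head G e) * ?p e)"
      unfolding in_arcs_def by (rule sum.group[symmetric]) auto
    also have "(\<Sum>e\<in>arcs G. f (tail G e) * ?n e) = (\<Sum>v\<in>verts G. \<Sum>e\<in>out_arcs G v. f (tail G e) * ?n e)"
      unfolding out_arcs_def by (rule sum.group[symmetric]) auto
    also have "(\<Sum>v\<in>verts G. \<Sum>e\<in>in_arcs G v. f (head G e) * ?p e)
        - (\<Sum>v\<in>verts G. \<Sum>e\<in>out_arcs G v. f (tail G e) * ?n e)
      = (\<Sum>v\<in>verts G. f v * ((\<Sum>e\<in>in_arcs G v. ?p e) - (\<Sum>e\<in>out_arcs G v. ?n e)))"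
      unfolding sum_subtractf[symmetric] right_diff_distrib sum_distrib_left
      by (intro sum.cong arg_cong2[where f = "(-)"]) (auto simp: in_arcs_def out_arcs_def)
    also have "\<dots> = ell2_inner (verts G) mV f ?h"
      unfolding ell2_inner_def
    proof (intro sum.cong refl)
      fix v assume v: "v \<in> verts G"
      have "cnj (?h v) * complex_of_real (mV v) = (\<Sum>e\<in>in_arcs G v. ?p e) - (\<Sum>e\<in>out_arcs G v. ?n e)"
        using v mV_pos[OF v] by (simp add: exp_cnj mult_ac)
      then show "f v * ((\<Sum>e\<in>in_arcs G v. ?p e) - (\<Sum>e\<in>out_arcs G v. ?n e)) =
          f v * cnj (?h v) * complex_of_real (mV v)"
        by (simp only: mult.assoc)
    qed
    finally show ?thesis .
  qed
  show "?h \<in> ell2 (verts G) \<and>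
      (\<forall>f\<in>ell2 (verts G). ell2_inner (arcs G) mE (magnetic_d G \<alpha> f) \<eta> = ell2_inner (verts G) mV f ?h)"
    using mem adj by blast
  show "h = ?h" if "h \<in> ell2 (verts G) \<and>
      (\<forall>f\<in>ell2 (verts G). ell2_inner (arcs G) mE (magnetic_d G \<alpha> f) \<eta> = ell2_inner (verts G) mV f h)" for h
    by (rule ell2_inner_left_cancel[where m = mV, OF finite_verts mV_pos])
      (use that mem adj in auto)
qed

end

end

theory Submission
  imports Defs
begin

text \<open>
  Let \<open>T\<close> be the Laplacian of the acyclic graph \<open>G - A\<close>, with eigenvalues \<open>\<mu>\<^sub>i\<close>, and let \<open>D\<close> be the
  Laplacian of \<open>G\<close> with a Dirichlet condition at \<open>v\<^sub>0\<close>, with eigenvalues \<open>\<nu>\<^sub>j\<close>; there is one \<open>\<mu>\<close> more than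
  there are \<open>\<nu>\<close>.  By a gauge transformation every vector potential may be assumed to vanish off \<open>A\<close>.
  Then \<open>T\<close> is a lower bound for the magnetic Laplacian, and \<open>D\<close> is its compression to the functions
  vanishing at \<open>v\<^sub>0\<close>; neither depends on the potential.  Interlacing confines all the spectra to a union
  of intervals of total length at most \<open>2\<rho>\<^sub>\<infinity> - (tr T - tr D)\<close>, and \<open>tr T - tr D = \<delta>\<close>.
\<close>

section \<open>Potentials on acyclic graphs\<close>

text \<open>On an acyclic edge set every potential is a difference of vertex values \<theta>, and
  multiplication by the phases exp(i \<theta>) conjugates such a difference away. Once the potential
  vanishes off \<open>A\<close>, deleting \<open>A\<close> only drops nonnegative terms from the
  quadratic form, which gives the lower bound \<open>T\<close>. Each edge of \<open>A\<close> ends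
  at the centre vertex, so for a function vanishing there at most one of the two terms of the
  differential survives on such an edge, and its modulus does not see the phase; this is why
  \<open>D\<close> is common to all potentials. The spectra are compared only through counts. For
  each real z, the number of \<mu> with \<mu> \<le> z minus the number of \<nu> with \<nu> < z is
  never negative, and it is at least 1 if z is an eigenvalue for some potential, because the
  eigenvector is an additional trial direction. The strict inequality for \<nu> leaves room for that
  direction even when z equals some \<nu> and the eigenvector vanishes at the centre. Integrating
  the difference of the counts bounds the measure of the union of all spectra.\<close>

lemma undirected_path_exists:
  assumes "(x, y) \<in> {(x, y). \<exists>e\<in>F. {tail G e, head G e} = {x, y}}\<^sup>*"
  obtains vs es where "length vs = Suc (length es)" "distinct vs" "set es \<subseteq> F" "vs ! 0 = x" "vs ! length es = y"
    "\<And>i. i < length es \<Longrightarrow> {tail G (es ! i), head G (es ! i)} = {vs ! i, vs ! Suc i}"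
proof -
  define P where "P y vs es \<longleftrightarrow> length vs = Suc (length es) \<and> distinct vs \<and> set es \<subseteq> F \<and> vs ! 0 = x \<and>
    vs ! length es = y \<and> (\<forall>i<length es. {tail G (es ! i), head G (es ! i)} = {vs ! i, vs ! Suc i})"
    for y vs es
  have "\<exists>vs es. P y vs es"
    using assms
  proof (induction rule: rtrancl_induct)
    case base
    show ?case by (intro exI[of _ "[x]"] exI[of _ "[]"]) (simp add: P_def)
  next
    case (step y z)
    then obtain vs es e where P: "P y vs es" and e: "e \<in> F" "{tail G e, head G e} = {y, z}"
      by auto
    show ?case
    \<comment> \<open>Returning to a visited vertex cuts the path back to that vertex, which keeps
      the vertices distinct.\<close>
    proof (cases "z \<in> set vs")
      case True
      then obtain i where "i < length vs" "vs ! i = z"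
        by (auto simp: in_set_conv_nth)
      with P have "P z (take (Suc i) vs) (take i es)"
        using set_take_subset[of i es] by (auto simp: P_def)
      then show ?thesis by blast
    next
      case False
      with P e have "P z (vs @ [z]) (es @ [e])"
        by (auto simp: P_def nth_append less_Suc_eq)
      then show ?thesis by blast
    qed
  qed
  then show ?thesis using that by (auto simp: P_def)
qed

text \<open>In contrapositive form: an edge added to \<open>F\<close> without creating a cycle joins
  two different components of \<open>F\<close>. This drives the induction in
  \<open>acyclic_potential\<close>. The reflexive case of the closure accounts for loops, as cycles
  of length 1.\<close>

lemma undirected_cycle_closing_edge:
  assumes "(head G e, tail G e) \<in> {(x, y). \<exists>e\<in>F. {tail G e, head G e} = {x, y}}\<^sup>*" "e \<notin> F"
  shows "\<exists>vs es. undirected_cycle (G\<lparr>arcs := insert e F\<rparr>) vs es"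
proof -
  obtain vs es where p: "length vs = Suc (length es)" "distinct vs" "set es \<subseteq> F" "vs ! 0 = head G e"
    "vs ! length es = tail G e"
    "\<And>i. i < length es \<Longrightarrow> {tail G (es ! i), head G (es ! i)} = {vs ! i, vs ! Suc i}"
    using undirected_path_exists[OF assms(1)] by metis
  \<comment> \<open>Equal edges have equal pairs of ends, and in a path with distinct vertices a
    pair of consecutive vertices fixes its position.\<close>
  have "i = j" if ij: "i < length es" "j < length es" "es ! i = es ! j" for i j
  proof -
    have "{vs ! i, vs ! Suc i} = {vs ! j, vs ! Suc j}"
      using p(6)[OF ij(1)] p(6)[OF ij(2)] ij(3) by simp
    then show ?thesis
      using ij(1,2) p(1) nth_eq_iff_index_eq[OF p(2)] by (auto simp: doubleton_eq_iff)
  qed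
  then have "distinct es"
    by (auto simp: distinct_conv_nth)
  have "{tail G ((es @ [e]) ! i), head G ((es @ [e]) ! i)} =
      {vs ! i, vs ! (Suc i mod length (es @ [e]))}" if "i < length (es @ [e])" for i
  proof (cases "i = length es")
    case True
    with p(4,5) show ?thesis by simp
  next
    case False
    with that p(6)[of i] show ?thesis by (simp add: nth_append)
  qed
  then have "undirected_cycle (G\<lparr>arcs := insert e F\<rparr>) vs (es @ [e])"
    using p(1-3) \<open>distinct es\<close> assms(2) by (auto simp: undirected_cycle_def)
  then show ?thesis by blast
qed

text \<open>Edges are inserted one by one. The ends of a new edge lie in different components of
  \<open>F\<close>, so adding a constant \<open>c\<close> to \<theta> on the component of
  \<open>head G e\<close> corrects the new edge without disturbing the old ones. Tail minus head is
  the sign that cancels \<alpha> in \<open>magnetic_d_gauge\<close>.\<close>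

lemma acyclic_potential:
  fixes \<alpha> :: "'e \<Rightarrow> real" and G :: "('v, 'e) pre_digraph"
  assumes "finite F" and "\<nexists>vs es. undirected_cycle (G\<lparr>arcs := F\<rparr>) vs es"
  shows "\<exists>\<theta>. \<forall>e\<in>F. \<theta> (tail G e) - \<theta> (head G e) = \<alpha> e"
  using assms
proof (induction F)
  case empty
  show ?case by simp
next
  case (insert e F)
  have "\<nexists>vs es. undirected_cycle (G\<lparr>arcs := F\<rparr>) vs es"
    using insert.prems by (auto simp: undirected_cycle_def)
  then obtain \<theta> where \<theta>: "\<And>e. e \<in> F \<Longrightarrow> \<theta> (tail G e) - \<theta> (head G e) = \<alpha> e"
    using insert.IH by blast
  let ?R = "{(x, y). \<exists>e\<in>F. {tail G e, head G e} = {x, y}}"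
  define c where "c = \<theta> (tail G e) - \<theta> (head G e) - \<alpha> e"
  define \<theta>' where "\<theta>' v = \<theta> v + (if (head G e, v) \<in> ?R\<^sup>* then c else 0)" for v
  have "(head G e, tail G e) \<notin> ?R\<^sup>*"
    using undirected_cycle_closing_edge[of G e F] insert by blast
  then have "\<theta>' (tail G e) - \<theta>' (head G e) = \<alpha> e"
    by (simp add: \<theta>'_def c_def)
  moreover have "\<theta>' (tail G d) - \<theta>' (head G d) = \<alpha> d" if d: "d \<in> F" for d
  proof -
    have "(tail G d, head G d) \<in> ?R" "(head G d, tail G d) \<in> ?R"
      using d by auto
    then have "(head G e, tail G d) \<in> ?R\<^sup>* \<longleftrightarrow> (head G e, head G d) \<in> ?R\<^sup>*"
      by (meson rtrancl.rtrancl_into_rtrancl)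
    then show ?thesis
      using \<theta>[OF d] by (simp add: \<theta>'_def)
  qed
  ultimately show ?case by blast
qed

lemma acyclic_no_loop:
  assumes "\<nexists>vs es. undirected_cycle (G\<lparr>arcs := F\<rparr>) vs es" "e \<in> F"
  shows "tail G e \<noteq> head G e"
proof
  assume "tail G e = head G e"
  then have "undirected_cycle (G\<lparr>arcs := F\<rparr>) [tail G e] [e]"
    using assms(2) by (simp add: undirected_cycle_def)
  with assms(1) show False by blast
qed

section \<open>Hermitian forms on finite-dimensional spaces\<close>

text \<open>Gaussian elimination: equation \<open>j\<close> is solved for a pivot unknown
  \<open>k\<close>, and substitution leaves one equation and one unknown fewer. The dimension
  arguments below reduce to this count, since \<open>ell2 X\<close> is a subset of a function type
  and not a type of its own.\<close>

lemma homogeneous_system_nontrivial: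
  fixes a :: "'i \<Rightarrow> 'j \<Rightarrow> 'a::field"
  assumes "finite J" "finite I" "card J < card I"
  shows "\<exists>c. (\<exists>i\<in>I. c i \<noteq> 0) \<and> (\<forall>j\<in>J. (\<Sum>i\<in>I. c i * a i j) = 0)"
  using assms
proof (induction J arbitrary: I a)
  case empty
  then have "I \<noteq> {}" by auto
  then show ?case by (intro exI[of _ "\<lambda>_. 1"]) auto
next
  case (insert j J)
  show ?case
  proof (cases "\<forall>i\<in>I. a i j = 0")
    case True
    from insert obtain c where "\<exists>i\<in>I. c i \<noteq> 0" "\<forall>l\<in>J. (\<Sum>i\<in>I. c i * a i l) = 0"
      by (metis card_insert_disjoint Suc_lessD)
    with True show ?thesis by (intro exI[of _ c]) auto
  next
    case False
    then obtain k where k: "k \<in> I" "a k j \<noteq> 0" by blast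
    have "card J < card (I - {k})"
      using insert.prems insert.hyps k by simp
    from insert.IH[OF _ this, of "\<lambda>i l. a i l - a i j / a k j * a k l"] insert.prems
    obtain c where c: "\<exists>i\<in>I - {k}. c i \<noteq> 0"
      "\<And>l. l \<in> J \<Longrightarrow> (\<Sum>i\<in>I - {k}. c i * (a i l - a i j / a k j * a k l)) = 0"
      by auto
    define c' where "c' i = (if i = k then - (\<Sum>i\<in>I - {k}. c i * a i j) / a k j else c i)" for i
    have expand: "(\<Sum>i\<in>I. c' i * a i l) =
        (\<Sum>i\<in>I - {k}. c i * a i l) - (\<Sum>i\<in>I - {k}. c i * a i j) / a k j * a k l" for l
      using insert.prems k by (subst sum.remove[of _ k]) (auto simp: c'_def intro!: sum.cong)
    have "(\<Sum>i\<in>I. c' i * a i l) = (\<Sum>i\<in>I - {k}. c i * (a i l - a i j / a k j * a k l))" for l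
      unfolding expand by (simp add: sum_subtractf right_diff_distrib sum_divide_distrib sum_distrib_right mult.assoc)
    moreover have "(\<Sum>i\<in>I. c' i * a i j) = 0"
      unfolding expand using k by simp
    moreover have "\<exists>i\<in>I. c' i \<noteq> 0"
      using c(1) by (auto simp: c'_def)
    ultimately show ?thesis
      using c(2) by (intro exI[of _ c']) auto
  qed
qed

text \<open>Positivity is left out so that the shifted forms "q minus r times the inner product",
  which may be indefinite, are instances too.\<close>

locale hermitian_form =
  fixes q :: "('x \<Rightarrow> complex) \<Rightarrow> ('x \<Rightarrow> complex) \<Rightarrow> complex"
  assumes add_left: "q (\<lambda>x. f x + g x) h = q f h + q g h"
    and scale_left: "q (\<lambda>x. c * f x) h = c * q f h"
    and herm: "q g f = cnj (q f g)"
begin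

lemma add_right: "q f (\<lambda>x. g x + h x) = q f g + q f h"
  by (subst (1 2 3) herm) (simp add: add_left)

lemma scale_right: "q f (\<lambda>x. c * g x) = cnj c * q f g"
  by (subst (1 2) herm) (simp add: scale_left)

lemma zero_left: "q (\<lambda>x. 0) g = 0"
  using scale_left[of 0 "\<lambda>x. 0" g] by simp

lemma sum_left: "q (\<lambda>x. \<Sum>i\<in>I. c i * f i x) g = (\<Sum>i\<in>I. c i * q (f i) g)"
  by (induction I rule: infinite_finite_induct) (simp_all add: zero_left add_left scale_left)

lemma sum_right: "q g (\<lambda>x. \<Sum>i\<in>I. c i * f i x) = (\<Sum>i\<in>I. cnj (c i) * q g (f i))"
  by (subst (1 2) herm) (simp add: sum_left)

lemma diag_real: "q f f = of_real (Re (q f f))"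
  using herm[of f f] by (metis Reals_cnj_iff of_real_Re)

text \<open>The first-order condition at a minimum with value 0. With
  \<open>t = - s * cnj (q g f)\<close> the form at \<open>f + t * g\<close> equals -2sN + s^2 N r,
  where N is the squared modulus of \<open>q g f\<close> and r = \<open>q g g\<close>. This is
  negative as soon as s r < 2 and N > 0, which the choice s = 1 / (|r| + 1) ensures.\<close>

lemma isotropic_kernel:
  assumes nonneg: "\<And>t. 0 \<le> Re (q (\<lambda>x. f x + t * g x) (\<lambda>x. f x + t * g x))"
    and "q f f = 0"
  shows "q g f = 0"
proof (rule ccontr)
  assume "q g f \<noteq> 0"
  define N where "N = (cmod (q g f))\<^sup>2"
  define r where "r = Re (q g g)"
  define s where "s = 1 / (\<bar>r\<bar> + 1)"
  have s: "0 < s" "s * r \<le> 1"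
    by (auto simp: s_def field_simps)
  have N: "0 < N" "q g f * cnj (q g f) = of_real N"
    using \<open>q g f \<noteq> 0\<close> by (simp_all add: N_def complex_norm_square[unfolded of_real_power])
  define t where "t = - (of_real s * cnj (q g f))"
  have "q (\<lambda>x. f x + t * g x) (\<lambda>x. f x + t * g x) =
      t * q g f + cnj t * cnj (q g f) + t * cnj t * q g g"
    using assms(2) herm[of f g]
    by (simp add: add_left add_right scale_left scale_right algebra_simps)
  also have "\<dots> = of_real (- 2 * s * N + s\<^sup>2 * N * r)"
  proof -
    have "t * q g f = of_real (- s * N)"
      using N(2) by (simp add: t_def mult_ac)
    moreover have "cnj t * cnj (q g f) = of_real (- s * N)"
      using N(2) by (simp add: t_def mult_ac)
    moreover have "t * cnj t = of_real (s\<^sup>2 * N)"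
      using N(2) by (simp add: t_def mult_ac power2_eq_square)
    moreover have "q g g = of_real r"
      unfolding r_def by (rule diag_real)
    ultimately show ?thesis by simp
  qed
  finally have "0 \<le> - 2 * s * N + s\<^sup>2 * N * r"
    using nonneg[of t] by simp
  also have "\<dots> = s * N * (s * r - 2)"
    by (simp add: power2_eq_square algebra_simps)
  also have "\<dots> < 0"
    using s N(1) by (intro mult_pos_neg) auto
  finally show False by simp
qed

end

lemma hermitian_form_diff_scale:
  assumes "hermitian_form p" "hermitian_form q"
  shows "hermitian_form (\<lambda>f g. p f g - of_real r * q f g)"
proof -
  interpret p: hermitian_form p by fact
  interpret q: hermitian_form q by fact
  show ?thesis
  proof
    show "p g f - of_real r * q g f = cnj (p f g - of_real r * q f g)" for f g
      using p.herm[of g f] q.herm[of g f] by simp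
  qed (simp_all add: p.add_left q.add_left p.scale_left q.scale_left algebra_simps)
qed

lemma hermitian_form_ell2_inner:
  assumes "\<And>f g y. y \<in> Y \<Longrightarrow> T (\<lambda>x. f x + g x) y = T f y + T g y"
    and "\<And>c f y. y \<in> Y \<Longrightarrow> T (\<lambda>x. c * f x) y = c * T f y"
  shows "hermitian_form (\<lambda>f g. ell2_inner Y m (T f) (T g))"
  by standard
    (use assms in \<open>simp_all add: ell2_inner_def sum_distrib_left ring_distribs sum.distrib mult_ac cong: sum.cong\<close>)

lemma hermitian_form_inner: "hermitian_form (ell2_inner X m)"
  using hermitian_form_ell2_inner[of X "\<lambda>f. f" m] by simp

section \<open>Weighted inner products on a finite set, and the spectral theorem for Hermitian
  forms\<close>

lemma ell2_inner_self:
  "ell2_inner X m f f = of_real (\<Sum>x\<in>X. (cmod (f x))\<^sup>2 * m x)"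
  unfolding ell2_inner_def by (simp flip: complex_norm_square)

lemma ell2_inner_delta:
  assumes "finite X" "x \<in> X"
  shows "ell2_inner X m f (\<lambda>y. of_bool (y = x)) = f x * of_real (m x)"
proof -
  have "ell2_inner X m f (\<lambda>y. of_bool (y = x)) = (\<Sum>y\<in>X. if y = x then f y * of_real (m y) else 0)"
    unfolding ell2_inner_def by (intro sum.cong) auto
  then show ?thesis using assms by simp
qed

lemma ell2_eq_sum_delta:
  assumes "finite X" "f \<in> ell2 X"
  shows "f = (\<lambda>y. \<Sum>x\<in>X. f x * of_bool (y = x))"
proof
  fix y
  have "(\<Sum>x\<in>X. f x * of_bool (y = x)) = (\<Sum>x\<in>X. if x = y then f x else 0)"
    by (intro sum.cong) auto
  then show "f y = (\<Sum>x\<in>X. f x * of_bool (y = x))"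
    using assms by (simp add: ell2_def)
qed

lemma ell2_mono: "X \<subseteq> Y \<Longrightarrow> ell2 X \<subseteq> ell2 Y"
  by (auto simp: ell2_def)

lemma ell2_sum: "(\<And>i. i \<in> I \<Longrightarrow> f i \<in> ell2 X) \<Longrightarrow> (\<lambda>x. \<Sum>i\<in>I. c i * f i x) \<in> ell2 X"
  by (simp add: ell2_def)

lemma ell2_delta: "x \<in> X \<Longrightarrow> (\<lambda>y. of_bool (y = x)) \<in> ell2 X"
  by (auto simp: ell2_def)

lemma compact_PiE_UNIV:
  fixes S :: "'x \<Rightarrow> 'a::topological_space set"
  assumes "\<And>x. compact (S x)"
  shows "compact (Pi\<^sub>E UNIV S)"
  using compactin_PiE[of "\<lambda>_. euclidean" UNIV S] assms
  by (simp add: euclidean_product_topology)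

lemma continuous_ell2_inner_self: "continuous_on UNIV (\<lambda>f. ell2_inner X m f f)"
  unfolding ell2_inner_def by (intro continuous_intros continuous_on_product_coordinates)

text \<open>In the product topology on functions this is Tychonoff: coordinates in \<open>X\<close>
  are bounded by \<open>sqrt (1 / m x)\<close>, and all others are pinned to 0.\<close>

lemma compact_ell2_sphere:
  assumes "finite X" and pos: "\<forall>x\<in>X. 0 < m x"
  shows "compact {f \<in> ell2 X. ell2_inner X m f f = 1}"
proof -
  define S :: "'a \<Rightarrow> complex set" where
    "S x = (if x \<in> X then cball 0 (sqrt (1 / m x)) else {0})" for x
  have bound: "cmod (f x) \<le> sqrt (1 / m x)" if "ell2_inner X m f f = 1" "x \<in> X" for f x
  proof -
    have "(cmod (f x))\<^sup>2 * m x \<le> (\<Sum>x\<in>X. (cmod (f x))\<^sup>2 * m x)"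
      using \<open>x \<in> X\<close> \<open>finite X\<close> by (intro member_le_sum) (use pos in \<open>auto simp: less_imp_le\<close>)
    also have "\<dots> = 1"
      using that(1) unfolding ell2_inner_self by (metis of_real_eq_1_iff)
    finally show ?thesis
      using pos \<open>x \<in> X\<close> by (intro real_le_rsqrt) (simp add: field_simps)
  qed
  have "{f \<in> ell2 X. ell2_inner X m f f = 1} = Pi\<^sub>E UNIV S \<inter> {f. ell2_inner X m f f = 1}"
  proof (intro equalityI subsetI)
    fix f assume "f \<in> {f \<in> ell2 X. ell2_inner X m f f = 1}"
    then show "f \<in> Pi\<^sub>E UNIV S \<inter> {f. ell2_inner X m f f = 1}"
      using bound[of f] by (auto simp: S_def ell2_def)
  next
    fix f assume f: "f \<in> Pi\<^sub>E UNIV S \<inter> {f. ell2_inner X m f f = 1}"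
    then have "f x = 0" if "x \<notin> X" for x
      using that by (auto simp: S_def PiE_def Pi_def dest!: spec[of _ x] split: if_splits)
    with f show "f \<in> {f \<in> ell2 X. ell2_inner X m f f = 1}"
      by (simp add: ell2_def)
  qed
  moreover have "compact (Pi\<^sub>E UNIV S)"
    by (rule compact_PiE_UNIV) (simp add: S_def)
  moreover have "closed {f. ell2_inner X m f f = 1}"
    by (intro closed_Collect_eq continuous_ell2_inner_self continuous_intros)
  ultimately show ?thesis
    by (simp add: compact_Int_closed)
qed

text \<open>An orthonormal family of \<open>k\<close> eigenvectors, possibly incomplete, so that it
  can be extended one vector at a time. The eigenvalue equation is tested against functions in
  \<open>ell2 X\<close>, which avoids introducing an operator for the form. The eigenvalues are not
  ordered.\<close>

definition eigensystem ::
  "'x set \<Rightarrow> ('x \<Rightarrow> real) \<Rightarrow> (('x \<Rightarrow> complex) \<Rightarrow> ('x \<Rightarrow> complex) \<Rightarrow> complex) \<Rightarrow>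
   nat \<Rightarrow> (nat \<Rightarrow> 'x \<Rightarrow> complex) \<Rightarrow> (nat \<Rightarrow> real) \<Rightarrow> bool" where
  "eigensystem X m q k b \<mu> \<longleftrightarrow>
     (\<forall>i<k. b i \<in> ell2 X) \<and>
     (\<forall>i<k. \<forall>j<k. ell2_inner X m (b i) (b j) = of_bool (i = j)) \<and>
     (\<forall>i<k. \<forall>g\<in>ell2 X. q g (b i) = of_real (\<mu> i) * ell2_inner X m g (b i))"

lemma ell2_inner_self_eq_0:
  assumes "finite X" "\<forall>x\<in>X. 0 < m x" "f \<in> ell2 X" "ell2_inner X m f f = 0"
  shows "f = (\<lambda>_. 0)"
proof -
  have "(\<Sum>x\<in>X. (cmod (f x))\<^sup>2 * m x) = 0"
    using assms(4) unfolding ell2_inner_self by (metis of_real_eq_0_iff)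
  then have "\<forall>x\<in>X. (cmod (f x))\<^sup>2 * m x = 0"
    using assms(1,2) by (subst (asm) sum_nonneg_eq_0_iff) (auto simp: less_imp_le)
  then have "f x = 0" if "x \<in> X" for x
    using assms(2) that by fastforce
  moreover have "f x = 0" if "x \<notin> X" for x
    using assms(3) that by (simp add: ell2_def)
  ultimately show ?thesis by blast
qed

lemma ell2_normalize:
  assumes "finite X" "\<forall>x\<in>X. 0 < m x" "f \<in> ell2 X" "f \<noteq> (\<lambda>_. 0)"
  obtains s :: real where "0 < s"
    "ell2_inner X m (\<lambda>x. of_real s * f x) (\<lambda>x. of_real s * f x) = 1"
proof -
  interpret inn: hermitian_form "ell2_inner X m" by (rule hermitian_form_inner)
  define N where "N = (\<Sum>x\<in>X. (cmod (f x))\<^sup>2 * m x)"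
  have N: "ell2_inner X m f f = of_real N"
    by (simp only: ell2_inner_self N_def)
  have "0 \<le> N"
    unfolding N_def by (intro sum_nonneg) (use assms(2) in \<open>auto simp: less_imp_le\<close>)
  moreover have "N \<noteq> 0"
    using ell2_inner_self_eq_0[OF assms(1-3)] assms(4) N by (metis of_real_0)
  ultimately have "0 < N" by simp
  moreover have "of_real (1 / sqrt N) * (of_real (1 / sqrt N) * of_real N) = (1 :: complex)"
    using \<open>0 < N\<close> by (simp flip: of_real_mult add: field_simps)
  ultimately show ?thesis
    using that[of "1 / sqrt N"]
    by (simp only: inn.scale_left inn.scale_right complex_cnj_complex_of_real N) simp
qed

lemma orthogonal_vector_exists:
  assumes "finite X" "\<forall>x\<in>X. 0 < m x" "finite I" "card I < card X"
  obtains w where "w \<in> ell2 X" "ell2_inner X m w w = 1" "\<And>i. i \<in> I \<Longrightarrow> ell2_inner X m w (b i) = 0"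
proof -
  interpret inn: hermitian_form "ell2_inner X m" by (rule hermitian_form_inner)
  obtain c where c: "\<exists>x\<in>X. c x \<noteq> 0" "\<forall>i\<in>I. (\<Sum>x\<in>X. c x * (cnj (b i x) * of_real (m x))) = 0"
    using homogeneous_system_nontrivial[OF assms(3,1,4), of "\<lambda>x i. cnj (b i x) * of_real (m x)"] by blast
  define w where "w x = (if x \<in> X then c x else 0)" for x
  have "w \<in> ell2 X" "w \<noteq> (\<lambda>_. 0)"
    using c(1) by (auto simp: w_def ell2_def fun_eq_iff)
  then obtain s where s: "ell2_inner X m (\<lambda>x. of_real s * w x) (\<lambda>x. of_real s * w x) = 1"
    using ell2_normalize[where X = X and m = m and f = w] assms(1,2) by blast
  have "ell2_inner X m w (b i) = 0" if "i \<in> I" for i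
    using c(2) that by (simp add: ell2_inner_def w_def mult.assoc)
  then have "ell2_inner X m (\<lambda>x. of_real s * w x) (b i) = 0" if "i \<in> I" for i
    using that by (simp only: inn.scale_left mult_zero_right)
  moreover have "(\<lambda>x. of_real s * w x) \<in> ell2 X"
    using \<open>w \<in> ell2 X\<close> by (simp add: ell2_def)
  ultimately show ?thesis
    using s that by blast
qed

text \<open>The new vector minimises the form on the unit sphere of the orthogonal complement of the
  old ones. The form shifted by the minimum \<open>r\<close> is nonnegative on the complement and
  vanishes at the minimiser, so \<open>isotropic_kernel\<close> yields the eigenvalue equation
  there.\<close>

lemma eigensystem_extend:
  assumes X: "finite X" "\<forall>x\<in>X. 0 < m x"
    and q: "hermitian_form q" "continuous_on UNIV (\<lambda>f. q f f)"
    and es: "eigensystem X m q k b \<mu>" and k: "k < card X"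
  obtains v r where "eigensystem X m q (Suc k) (b(k := v)) (\<mu>(k := r))"
proof -
  interpret inn: hermitian_form "ell2_inner X m" by (rule hermitian_form_inner)
  interpret q: hermitian_form q by fact
  have b: "\<And>i. i < k \<Longrightarrow> b i \<in> ell2 X"
    and orth: "\<And>i j. i < k \<Longrightarrow> j < k \<Longrightarrow> ell2_inner X m (b i) (b j) = of_bool (i = j)"
    and eig: "\<And>i g. i < k \<Longrightarrow> g \<in> ell2 X \<Longrightarrow> q g (b i) = of_real (\<mu> i) * ell2_inner X m g (b i)"
    using es by (auto simp: eigensystem_def)
  let ?W = "{f \<in> ell2 X. \<forall>i<k. ell2_inner X m f (b i) = 0}"
  let ?K = "{f \<in> ell2 X. ell2_inner X m f f = 1} \<inter> (\<Inter>i\<in>{..<k}. {f. ell2_inner X m f (b i) = 0})"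
  have "closed {f. ell2_inner X m f (b i) = 0}" for i
    unfolding ell2_inner_def
    by (intro closed_Collect_eq continuous_intros continuous_on_product_coordinates)
  then have "compact ?K"
    by (intro compact_Int_closed compact_ell2_sphere X closed_INT) auto
  moreover obtain w where "w \<in> ell2 X" "ell2_inner X m w w = 1" "\<And>i. i < k \<Longrightarrow> ell2_inner X m w (b i) = 0"
    using orthogonal_vector_exists[where X = X and m = m and I = "{..<k}" and b = b] X k by auto
  then have "?K \<noteq> {}" by blast
  moreover have "continuous_on ?K (\<lambda>f. Re (q f f))"
    by (intro continuous_intros continuous_on_subset[OF q(2)]) auto
  ultimately obtain v where v: "v \<in> ?K" and min: "\<And>f. f \<in> ?K \<Longrightarrow> Re (q v v) \<le> Re (q f f)"
    using continuous_attains_inf[of ?K "\<lambda>f. Re (q f f)"] by blast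
  define r where "r = Re (q v v)"
  have vX: "v \<in> ell2 X" and v1: "ell2_inner X m v v = 1"
    and vb: "\<And>i. i < k \<Longrightarrow> ell2_inner X m v (b i) = 0"
    using v by auto
  interpret p: hermitian_form "\<lambda>f g. q f g - of_real r * ell2_inner X m f g"
    by (rule hermitian_form_diff_scale) unfold_locales
  have nonneg: "0 \<le> Re (q f f - of_real r * ell2_inner X m f f)" if "f \<in> ?W" for f
  proof (cases "f = (\<lambda>_. 0)")
    case True
    then show ?thesis by (simp add: q.zero_left inn.zero_left)
  next
    case False
    have "f \<in> ell2 X" using that by simp
    from False obtain s :: real where "0 < s"
      and s: "ell2_inner X m (\<lambda>x. of_real s * f x) (\<lambda>x. of_real s * f x) = 1"
      using ell2_normalize[where X = X and m = m and f = f] X \<open>f \<in> ell2 X\<close> by blast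
    then have "(\<lambda>x. of_real s * f x) \<in> ?K"
      using that by (auto simp add: inn.scale_left[of _ f] ell2_def)
    from min[OF this] have "0 \<le> Re (q (\<lambda>x. of_real s * f x) (\<lambda>x. of_real s * f x) -
        of_real r * ell2_inner X m (\<lambda>x. of_real s * f x) (\<lambda>x. of_real s * f x))"
      unfolding s by (simp add: r_def)
    also have "\<dots> = s * (s * Re (q f f - of_real r * ell2_inner X m f f))"
      unfolding p.scale_left p.scale_right by simp
    finally show ?thesis
      using \<open>0 < s\<close> by (simp add: zero_le_mult_iff)
  qed
  have eigW: "q g v - of_real r * ell2_inner X m g v = 0" if "g \<in> ?W" for g
  proof (rule p.isotropic_kernel)
    show "q v v - of_real r * ell2_inner X m v v = 0"
      using v1 q.diag_real[of v] by (simp add: r_def)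
    have "(\<lambda>x. v x + t * g x) \<in> ?W" for t
      using vX vb that by (simp add: inn.add_left inn.scale_left ell2_def)
    then show "0 \<le> Re (q (\<lambda>x. v x + t * g x) (\<lambda>x. v x + t * g x) -
        of_real r * ell2_inner X m (\<lambda>x. v x + t * g x) (\<lambda>x. v x + t * g x))" for t
      by (rule nonneg)
  qed
  have bv: "ell2_inner X m (b i) v = 0" if "i < k" for i
    using vb[OF that] inn.herm[of "b i" v] by simp
  have qbv: "q (b i) v = 0" if "i < k" for i
    using eig[OF that vX] vb[OF that] q.herm[of "b i" v] by simp
  have "q g v = of_real r * ell2_inner X m g v" if g: "g \<in> ell2 X" for g
  proof -
    \<comment> \<open>\<open>g\<close> splits into its projection \<open>u\<close> on the old
      eigenvectors, against which both sides vanish, and a remainder in \<open>?W\<close>, where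
      \<open>eigW\<close> applies.\<close>
    define u where "u = (\<lambda>x. \<Sum>i<k. ell2_inner X m g (b i) * b i x)"
    define g' where "g' = (\<lambda>x. g x + (- 1) * u x)"
    have "ell2_inner X m u (b j) = ell2_inner X m g (b j)" if "j < k" for j
      using that by (simp add: u_def inn.sum_left orth)
    then have "ell2_inner X m g' (b j) = 0" if "j < k" for j
      using that unfolding g'_def inn.add_left inn.scale_left by simp
    moreover have "g' \<in> ell2 X"
      using g b by (simp add: g'_def u_def ell2_def)
    ultimately have "g' \<in> ?W" by blast
    from eigW[OF this] have "q g' v = of_real r * ell2_inner X m g' v" by simp
    moreover have "q u v = 0" "ell2_inner X m u v = 0"
      by (simp_all add: u_def inn.sum_left q.sum_left bv qbv)
    ultimately show ?thesis
      by (simp only: g'_def inn.add_left q.add_left inn.scale_left q.scale_left mult_zero_right add_0_right)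
  qed
  note eig_v = this
  define b' where "b' = b(k := v)"
  define \<mu>' where "\<mu>' = \<mu>(k := r)"
  have b'_less: "b' i = b i" "\<mu>' i = \<mu> i" if "i < k" for i
    using that by (simp_all add: b'_def \<mu>'_def)
  have b'_k: "b' k = v" "\<mu>' k = r"
    by (simp_all add: b'_def \<mu>'_def)
  have "q g (b' i) = of_real (\<mu>' i) * ell2_inner X m g (b' i)" if "g \<in> ell2 X" "i < Suc k" for g i
    using that(2) eig_v[OF that(1)] eig[OF _ that(1)] by (auto elim: less_SucE simp: b'_less b'_k)
  moreover have "b' i \<in> ell2 X" if "i < Suc k" for i
    using that b vX by (auto elim: less_SucE simp: b'_less b'_k)
  moreover have "ell2_inner X m (b' i) (b' j) = of_bool (i = j)" if "i < Suc k" "j < Suc k" for i j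
    using that(1)
  proof (rule less_SucE)
    assume "i < k"
    from that(2) show ?thesis
      by (rule less_SucE) (use \<open>i < k\<close> orth bv in \<open>simp_all add: b'_less b'_k\<close>)
  next
    assume "i = k"
    from that(2) show ?thesis
      by (rule less_SucE) (use \<open>i = k\<close> vb v1 in \<open>simp_all add: b'_less b'_k\<close>)
  qed
  ultimately have "eigensystem X m q (Suc k) b' \<mu>'"
    by (simp add: eigensystem_def)
  then have "eigensystem X m q (Suc k) (b(k := v)) (\<mu>(k := r))"
    by (simp only: b'_def \<mu>'_def)
  then show ?thesis by (rule that)
qed

lemma hermitian_eigensystem:
  assumes "finite X" "\<forall>x\<in>X. 0 < m x"
    and "hermitian_form q" "continuous_on UNIV (\<lambda>f. q f f)"
  obtains b \<mu> where "eigensystem X m q (card X) b \<mu>"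
proof -
  have "\<exists>b \<mu>. eigensystem X m q k b \<mu>" if "k \<le> card X" for k
    using that
  proof (induction k)
    case 0
    then show ?case by (simp add: eigensystem_def)
  next
    case (Suc k)
    then obtain b \<mu> where "eigensystem X m q k b \<mu>" by auto
    moreover have "k < card X" using Suc.prems by simp
    ultimately obtain v r where "eigensystem X m q (Suc k) (b(k := v)) (\<mu>(k := r))"
      by (rule eigensystem_extend[OF assms])
    then show ?case by blast
  qed
  then show ?thesis using that by blast
qed

text \<open>The eigenvectors together with the remainder \<open>w\<close> of \<open>f\<close> are
  one function more than \<open>X\<close> has points, hence dependent. Pairing the relation with
  each \<open>b j\<close> kills its coefficient, so \<open>w\<close> carries a nonzero one; pairing
  with \<open>w\<close> then makes \<open>w\<close> isotropic, hence zero.\<close>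

lemma eigensystem_expansion:
  assumes X: "finite X" "\<forall>x\<in>X. 0 < m x"
    and es: "eigensystem X m q (card X) b \<mu>" and f: "f \<in> ell2 X"
  shows "f = (\<lambda>x. \<Sum>i<card X. ell2_inner X m f (b i) * b i x)"
proof -
  interpret inn: hermitian_form "ell2_inner X m" by (rule hermitian_form_inner)
  have b: "\<And>i. i < card X \<Longrightarrow> b i \<in> ell2 X"
    and orth: "\<And>i j. i < card X \<Longrightarrow> j < card X \<Longrightarrow> ell2_inner X m (b i) (b j) = of_bool (i = j)"
    using es by (auto simp: eigensystem_def)
  define u where "u = (\<lambda>x. \<Sum>i<card X. ell2_inner X m f (b i) * b i x)"
  define w where "w = (\<lambda>x. f x + (- 1) * u x)"
  have uX: "u \<in> ell2 X"
    unfolding u_def by (rule ell2_sum) (simp add: b)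
  then have wX: "w \<in> ell2 X"
    using f by (simp add: w_def ell2_def)
  have wb: "ell2_inner X m w (b j) = 0" if "j < card X" for j
    unfolding w_def inn.add_left inn.scale_left u_def inn.sum_left
    using that by (simp add: orth)
  define B where "B i = (if i < card X then b i else w)" for i
  obtain c where c: "\<exists>i\<in>{..card X}. c i \<noteq> 0" "\<forall>x\<in>X. (\<Sum>i\<in>{..card X}. c i * B i x) = 0"
    using homogeneous_system_nontrivial[of X "{..card X}" B] X by auto
  have "(\<lambda>x. \<Sum>i\<in>{..card X}. c i * B i x) = (\<lambda>x. 0)"
  proof
    fix x
    have "B i \<in> ell2 X" for i
      using b wX by (simp add: B_def)
    with c(2) show "(\<Sum>i\<in>{..card X}. c i * B i x) = 0"
      by (cases "x \<in> X") (simp_all add: ell2_def)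
  qed
  then have rel: "(\<Sum>i<Suc (card X). c i * ell2_inner X m (B i) g) = 0" for g
    unfolding lessThan_Suc_atMost inn.sum_left[symmetric] by (simp only: inn.zero_left)
  have cj: "c j = 0" if "j < card X" for j
    using rel[of "b j"] that by (simp add: B_def orth wb)
  moreover have "c (card X) * ell2_inner X m w w = 0"
    using rel[of w] by (simp add: cj B_def)
  ultimately have "ell2_inner X m w w = 0"
    using c(1) by (metis atMost_iff le_neq_implies_less mult_eq_0_iff)
  from ell2_inner_self_eq_0[OF X wX this] show ?thesis
    by (simp add: w_def u_def fun_eq_iff)
qed

lemma eigensystem_diagonal:
  assumes X: "finite X" "\<forall>x\<in>X. 0 < m x"
    and q: "hermitian_form q"
    and es: "eigensystem X m q (card X) b \<mu>" and f: "f \<in> ell2 X"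
  shows "q f f = of_real (\<Sum>i<card X. \<mu> i * (cmod (ell2_inner X m f (b i)))\<^sup>2)"
    and "ell2_inner X m f f = of_real (\<Sum>i<card X. (cmod (ell2_inner X m f (b i)))\<^sup>2)"
proof -
  interpret inn: hermitian_form "ell2_inner X m" by (rule hermitian_form_inner)
  interpret q: hermitian_form q by fact
  let ?c = "\<lambda>i. ell2_inner X m f (b i)"
  let ?f = "\<lambda>x. \<Sum>i<card X. ?c i * b i x"
  have fe: "f = ?f"
    by (rule eigensystem_expansion[OF X es f])
  have "q f f = q f ?f"
    using fe by simp
  also have "\<dots> = (\<Sum>i<card X. cnj (?c i) * (of_real (\<mu> i) * ?c i))"
    unfolding q.sum_right using es f by (intro sum.cong) (auto simp: eigensystem_def)
  also have "\<dots> = of_real (\<Sum>i<card X. \<mu> i * (cmod (?c i))\<^sup>2)"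
    by (simp add: complex_norm_square mult_ac del: of_real_power)
  finally show "q f f = of_real (\<Sum>i<card X. \<mu> i * (cmod (?c i))\<^sup>2)" .
  have "ell2_inner X m f f = ell2_inner X m f ?f"
    using fe by simp
  also have "\<dots> = of_real (\<Sum>i<card X. (cmod (?c i))\<^sup>2)"
    unfolding inn.sum_right by (simp add: complex_norm_square mult_ac del: of_real_power)
  finally show "ell2_inner X m f f = of_real (\<Sum>i<card X. (cmod (?c i))\<^sup>2)" .
qed

text \<open>The trace is computed in two bases. The point mass at \<open>x\<close> has squared norm
  \<open>m x\<close>, which explains the division on the right; summing its squared coefficients
  over \<open>x\<close> gives the squared norm 1 of each eigenvector.\<close>

lemma eigensystem_trace:
  assumes X: "finite X" "\<forall>x\<in>X. 0 < m x"
    and q: "hermitian_form q"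
    and es: "eigensystem X m q (card X) b \<mu>"
  shows "(\<Sum>i<card X. \<mu> i) = (\<Sum>x\<in>X. Re (q (\<lambda>y. of_bool (y = x)) (\<lambda>y. of_bool (y = x))) / m x)"
proof -
  interpret inn: hermitian_form "ell2_inner X m" by (rule hermitian_form_inner)
  have "Re (q (\<lambda>y. of_bool (y = x)) (\<lambda>y. of_bool (y = x))) / m x =
      (\<Sum>i<card X. \<mu> i * ((cmod (b i x))\<^sup>2 * m x))" if "x \<in> X" for x
  proof -
    have "(cmod (ell2_inner X m (\<lambda>y. of_bool (y = x)) (b i)))\<^sup>2 = (cmod (b i x))\<^sup>2 * m x * m x" for i
      using ell2_inner_delta[OF X(1) that, of m "b i"] X(2) that
      by (subst inn.herm) (simp add: norm_mult power2_eq_square)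
    then have "Re (q (\<lambda>y. of_bool (y = x)) (\<lambda>y. of_bool (y = x))) =
        (\<Sum>i<card X. \<mu> i * ((cmod (b i x))\<^sup>2 * m x)) * m x"
      unfolding eigensystem_diagonal(1)[OF X q es ell2_delta[OF that]] Re_complex_of_real
      by (simp add: sum_distrib_left sum_distrib_right mult_ac)
    then show ?thesis
      using X(2) that by simp
  qed
  then have "(\<Sum>x\<in>X. Re (q (\<lambda>y. of_bool (y = x)) (\<lambda>y. of_bool (y = x))) / m x) =
      (\<Sum>x\<in>X. \<Sum>i<card X. \<mu> i * ((cmod (b i x))\<^sup>2 * m x))"
    by simp
  also have "\<dots> = (\<Sum>i<card X. \<mu> i * (\<Sum>x\<in>X. (cmod (b i x))\<^sup>2 * m x))"
    by (subst sum.swap) (simp add: sum_distrib_left)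
  also have "\<dots> = (\<Sum>i<card X. \<mu> i)"
  proof (intro sum.cong refl)
    fix i assume "i \<in> {..<card X}"
    then have "ell2_inner X m (b i) (b i) = 1"
      using es by (simp add: eigensystem_def)
    then have "(\<Sum>x\<in>X. (cmod (b i x))\<^sup>2 * m x) = 1"
      unfolding ell2_inner_self by (metis of_real_eq_1_iff)
    then show "\<mu> i * (\<Sum>x\<in>X. (cmod (b i x))\<^sup>2 * m x) = \<mu> i" by simp
  qed
  finally show ?thesis ..
qed

section \<open>Eigenvalue counts by the min-max principle\<close>

lemma eigensystem_Rayleigh:
  assumes es: "eigensystem X m q k b \<mu>" and i: "i < k"
  shows "Re (q (b i) (b i)) = \<mu> i" "Re (ell2_inner X m (b i) (b i)) = 1"
  using es i by (auto simp: eigensystem_def)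

text \<open>If the trial space had larger dimension than the number of eigenvalues up to
  \<open>z\<close>, a nontrivial combination \<open>u\<close> would be orthogonal to all their
  eigenvectors. On the remaining ones the form is strictly above \<open>z\<close>, so
  \<open>le\<close> forces \<open>u\<close> to be 0, against independence.\<close>

lemma eigenvalue_count_ge:
  assumes X: "finite X" "\<forall>x\<in>X. 0 < m x"
    and q: "hermitian_form q"
    and es: "eigensystem X m q (card X) b \<mu>"
    and J: "finite J" "\<And>j. j \<in> J \<Longrightarrow> w j \<in> ell2 X"
    and indep: "\<And>c. (\<lambda>x. \<Sum>j\<in>J. c j * w j x) = (\<lambda>_. 0) \<Longrightarrow> \<forall>j\<in>J. c j = 0"
    and le: "\<And>c. Re (q (\<lambda>x. \<Sum>j\<in>J. c j * w j x) (\<lambda>x. \<Sum>j\<in>J. c j * w j x)) \<le>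
        z * Re (ell2_inner X m (\<lambda>x. \<Sum>j\<in>J. c j * w j x) (\<lambda>x. \<Sum>j\<in>J. c j * w j x))"
  shows "card J \<le> card {i. i < card X \<and> \<mu> i \<le> z}"
proof (rule ccontr)
  interpret inn: hermitian_form "ell2_inner X m" by (rule hermitian_form_inner)
  assume "\<not> card J \<le> card {i. i < card X \<and> \<mu> i \<le> z}"
  then obtain c where c: "\<exists>j\<in>J. c j \<noteq> 0"
    "\<And>i. i < card X \<Longrightarrow> \<mu> i \<le> z \<Longrightarrow> (\<Sum>j\<in>J. c j * ell2_inner X m (w j) (b i)) = 0"
    using homogeneous_system_nontrivial[of "{i. i < card X \<and> \<mu> i \<le> z}" J "\<lambda>j i. ell2_inner X m (w j) (b i)"] J
    by auto
  define u where "u = (\<lambda>x. \<Sum>j\<in>J. c j * w j x)"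
  have u: "u \<in> ell2 X"
    unfolding u_def by (rule ell2_sum) (rule J)
  let ?d = "\<lambda>i. (cmod (ell2_inner X m u (b i)))\<^sup>2"
  have orth: "ell2_inner X m u (b i) = 0" if "i < card X" "\<mu> i \<le> z" for i
    using c(2)[OF that] by (simp add: u_def inn.sum_left)
  have "Re (q u u) \<le> z * Re (ell2_inner X m u u)"
    unfolding u_def by (rule le)
  then have "(\<Sum>i<card X. (\<mu> i - z) * ?d i) \<le> 0"
    unfolding eigensystem_diagonal[OF X q es u] Re_complex_of_real
    by (simp add: left_diff_distrib sum_subtractf sum_distrib_left)
  moreover have nn: "0 \<le> (\<mu> i - z) * ?d i" if "i < card X" for i
    using orth[OF that] by (cases "\<mu> i \<le> z") auto
  ultimately have "(\<Sum>i<card X. (\<mu> i - z) * ?d i) = 0"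
    by (intro antisym sum_nonneg) auto
  with nn have "\<forall>i<card X. (\<mu> i - z) * ?d i = 0"
    by (subst (asm) sum_nonneg_eq_0_iff) auto
  with orth have "ell2_inner X m u (b i) = 0" if "i < card X" for i
    using that by fastforce
  then have "u = (\<lambda>_. 0)"
    by (subst eigensystem_expansion[OF X es u]) simp
  with indep[of c] c(1) show False
    by (simp add: u_def)
qed

lemma ell2_inner_subset:
  assumes "finite X" "Y \<subseteq> X" "f \<in> ell2 Y"
  shows "ell2_inner X m f g = ell2_inner Y m f g"
  unfolding ell2_inner_def
  by (rule sum.mono_neutral_right) (use assms in \<open>auto simp: ell2_def\<close>)

text \<open>
  The trial space for the min-max argument is spanned by the eigenvectors of \<open>q\<^sub>2\<close> with \<open>\<nu>\<^sub>j < z\<close>, and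
  in the second part also by the eigenvector \<open>f\<close>, which is isotropic for \<open>q - z\<close> and orthogonal to
  everything with respect to that form.
\<close>

lemma eigenvalue_bracketing:
  assumes X: "finite X" "\<forall>x\<in>X. 0 < m x" and Y: "Y \<subseteq> X"
    and herm: "hermitian_form q\<^sub>1" "hermitian_form q\<^sub>2" "hermitian_form q"
    and es1: "eigensystem X m q\<^sub>1 (card X) a \<mu>"
    and es2: "eigensystem Y m q\<^sub>2 (card Y) b \<nu>"
    and le: "\<And>u. u \<in> ell2 X \<Longrightarrow> Re (q\<^sub>1 u u) \<le> Re (q u u)"
    and eq: "\<And>u. u \<in> ell2 Y \<Longrightarrow> q u u = q\<^sub>2 u u"
  shows "card {j. j < card Y \<and> \<nu> j < z} \<le> card {i. i < card X \<and> \<mu> i \<le> z}"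
    and "f \<in> ell2 X \<Longrightarrow> f \<noteq> (\<lambda>_. 0) \<Longrightarrow> (\<And>g. g \<in> ell2 X \<Longrightarrow> q g f = of_real z * ell2_inner X m g f) \<Longrightarrow>
      Suc (card {j. j < card Y \<and> \<nu> j < z}) \<le> card {i. i < card X \<and> \<mu> i \<le> z}"
proof -
  interpret inn: hermitian_form "ell2_inner X m" by (rule hermitian_form_inner)
  interpret innY: hermitian_form "ell2_inner Y m" by (rule hermitian_form_inner)
  interpret q: hermitian_form q by fact
  interpret q2: hermitian_form q\<^sub>2 by fact
  interpret p: hermitian_form "\<lambda>f g. q f g - of_real z * ell2_inner X m f g"
    by (rule hermitian_form_diff_scale) unfold_locales
  let ?p = "\<lambda>f g. q f g - of_real z * ell2_inner X m f g"
  define J where "J = {j. j < card Y \<and> \<nu> j < z}"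
  have finJ: "finite J" by (simp add: J_def)
  have bY: "b j \<in> ell2 Y" if "j \<in> J" for j
    using es2 that by (simp add: eigensystem_def J_def)
  have bX: "b j \<in> ell2 X" if "j \<in> J" for j
    using bY[OF that] ell2_mono[OF Y] by blast
  have low: "?p v v = of_real (\<Sum>j\<in>J. (\<nu> j - z) * (cmod (c j))\<^sup>2)" if v: "v = (\<lambda>x. \<Sum>j\<in>J. c j * b j x)" for v c
  proof -
    have vY: "v \<in> ell2 Y"
      unfolding v by (rule ell2_sum) (rule bY)
    have coeff: "ell2_inner Y m v (b j) = c j" if "j \<in> J" for j
    proof -
      have "ell2_inner Y m v (b j) = (\<Sum>i\<in>J. if i = j then c i else 0)"
        unfolding v innY.sum_left using es2 that
        by (intro sum.cong) (auto simp: eigensystem_def J_def)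
      then show ?thesis using that finJ by simp
    qed
    have "q\<^sub>2 v v = (\<Sum>j\<in>J. cnj (c j) * q\<^sub>2 v (b j))"
      using q2.sum_right[of v c b J] v by simp
    also have "\<dots> = (\<Sum>j\<in>J. cnj (c j) * (of_real (\<nu> j) * c j))"
      using es2 vY coeff by (intro sum.cong) (auto simp: eigensystem_def J_def)
    finally have 1: "q v v = (\<Sum>j\<in>J. of_real (\<nu> j) * (c j * cnj (c j)))"
      using eq[OF vY] by (simp add: mult_ac)
    have "ell2_inner X m v v = (\<Sum>j\<in>J. cnj (c j) * ell2_inner Y m v (b j))"
      using innY.sum_right[of v c b J] v ell2_inner_subset[OF X(1) Y vY, of m v] by simp
    also have "\<dots> = (\<Sum>j\<in>J. c j * cnj (c j))"
      using coeff by (intro sum.cong) auto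
    finally have 2: "ell2_inner X m v v = (\<Sum>j\<in>J. c j * cnj (c j))" .
    show ?thesis
      unfolding 1 2 sum_distrib_left sum_subtractf[symmetric] complex_norm_square[symmetric]
      by (simp add: left_diff_distrib)
  qed
  have low_le: "Re (?p v v) \<le> 0" if v: "v = (\<lambda>x. \<Sum>j\<in>J. c j * b j x)" for v c
    unfolding low[OF v] Re_complex_of_real
    by (rule sum_nonpos) (auto simp: J_def mult_nonpos_nonneg)
  \<comment> \<open>As \<open>J\<close> is cut out by a strict inequality, the shifted form is
    negative definite on this span. Both independence claims below come from this.\<close>
  have low_0: "\<forall>j\<in>J. c j = 0" if v: "v = (\<lambda>x. \<Sum>j\<in>J. c j * b j x)" and "?p v v = 0" for v c
  proof -
    have "(\<Sum>j\<in>J. (z - \<nu> j) * (cmod (c j))\<^sup>2) = - (\<Sum>j\<in>J. (\<nu> j - z) * (cmod (c j))\<^sup>2)"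
      by (simp add: sum_negf[symmetric] algebra_simps)
    also have "\<dots> = 0"
      using low[OF v] that(2) by (metis neg_equal_0_iff_equal of_real_eq_0_iff)
    finally have "(\<Sum>j\<in>J. (z - \<nu> j) * (cmod (c j))\<^sup>2) = 0" .
    then show ?thesis
      by (subst (asm) sum_nonneg_eq_0_iff[OF finJ]) (auto simp: J_def)
  qed
  have to_q1: "Re (q\<^sub>1 u u) \<le> z * Re (ell2_inner X m u u)" if "u \<in> ell2 X" "Re (?p u u) \<le> 0" for u
    using le[OF that(1)] that(2) by simp
  have "card J \<le> card {i. i < card X \<and> \<mu> i \<le> z}"
  proof (rule eigenvalue_count_ge[OF X herm(1) es1 finJ bX])
    show "\<forall>j\<in>J. c j = 0" if "(\<lambda>x. \<Sum>j\<in>J. c j * b j x) = (\<lambda>_. 0)" for c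
      by (rule low_0[OF refl]) (use that in \<open>simp add: p.zero_left\<close>)
    show "Re (q\<^sub>1 (\<lambda>x. \<Sum>j\<in>J. c j * b j x) (\<lambda>x. \<Sum>j\<in>J. c j * b j x)) \<le>
        z * Re (ell2_inner X m (\<lambda>x. \<Sum>j\<in>J. c j * b j x) (\<lambda>x. \<Sum>j\<in>J. c j * b j x))" for c
      by (intro to_q1 low_le[OF refl] ell2_sum bX)
  qed auto
  then show "card {j. j < card Y \<and> \<nu> j < z} \<le> card {i. i < card X \<and> \<mu> i \<le> z}"
    by (simp add: J_def)
  assume f: "f \<in> ell2 X" "f \<noteq> (\<lambda>_. 0)" and eig: "\<And>g. g \<in> ell2 X \<Longrightarrow> q g f = of_real z * ell2_inner X m g f"
  \<comment> \<open>A slot outside \<open>J\<close>, in which \<open>f\<close> can be stored as one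
    more trial vector.\<close>
  define k where "k = card Y"
  have k: "k \<notin> J" by (simp add: k_def J_def)
  define w where "w = b(k := f)"
  have wX: "w j \<in> ell2 X" if "j \<in> insert k J" for j
    using that bX f by (auto simp: w_def)
  let ?v = "\<lambda>c x. \<Sum>j\<in>J. c j * b j x"
  have split: "(\<lambda>x. \<Sum>j\<in>insert k J. c j * w j x) = (\<lambda>x. ?v c x + c k * f x)" for c
  proof
    fix x
    have "(\<Sum>j\<in>J. c j * w j x) = ?v c x"
      using k by (intro sum.cong) (auto simp: w_def)
    then show "(\<Sum>j\<in>insert k J. c j * w j x) = ?v c x + c k * f x"
      using k finJ by (simp add: w_def add.commute)
  qed
  have vX: "?v c \<in> ell2 X" for c
    by (intro ell2_sum bX)
  have pf: "?p g f = 0" if "g \<in> ell2 X" for g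
    using eig[OF that] by simp
  have pf': "?p f g = 0" if "g \<in> ell2 X" for g
    using pf[OF that] p.herm[of f g] by simp
  have p_split: "?p (\<lambda>x. \<Sum>j\<in>insert k J. c j * w j x) (\<lambda>x. \<Sum>j\<in>insert k J. c j * w j x) = ?p (?v c) (?v c)" for c
    unfolding split p.add_left p.add_right p.scale_left p.scale_right pf[OF vX] pf'[OF vX] pf[OF f(1)] by simp
  have "card (insert k J) \<le> card {i. i < card X \<and> \<mu> i \<le> z}"
  proof (rule eigenvalue_count_ge[OF X herm(1) es1 _ wX])
    show "\<forall>j\<in>insert k J. c j = 0" if 0: "(\<lambda>x. \<Sum>j\<in>insert k J. c j * w j x) = (\<lambda>_. 0)" for c
    proof -
      have cJ: "\<forall>j\<in>J. c j = 0"
        by (rule low_0[OF refl]) (use p_split[of c] 0 in \<open>simp add: p.zero_left\<close>)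
      then have "c k * f x = 0" for x
        using fun_cong[OF 0[unfolded split], of x] by simp
      with f(2) cJ show ?thesis by auto
    qed
    show "Re (q\<^sub>1 (\<lambda>x. \<Sum>j\<in>insert k J. c j * w j x) (\<lambda>x. \<Sum>j\<in>insert k J. c j * w j x)) \<le>
        z * Re (ell2_inner X m (\<lambda>x. \<Sum>j\<in>insert k J. c j * w j x) (\<lambda>x. \<Sum>j\<in>insert k J. c j * w j x))" for c
    proof (rule to_q1)
      show "Re (?p (\<lambda>x. \<Sum>j\<in>insert k J. c j * w j x) (\<lambda>x. \<Sum>j\<in>insert k J. c j * w j x)) \<le> 0"
        unfolding p_split by (rule low_le[OF refl])
    qed (intro ell2_sum wX)
  qed (use finJ in auto)
  then show "Suc (card {j. j < card Y \<and> \<nu> j < z}) \<le> card {i. i < card X \<and> \<mu> i \<le> z}"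
    using k finJ by (simp add: J_def)
qed

text \<open>
  Integrating the counting functions avoids ordering the eigenvalues and taking the union of the
  intervals \<open>[\<mu>\<^sub>k, \<nu>\<^sub>k]\<close>.
\<close>

lemma measure_le_of_counts:
  fixes \<mu> \<nu> :: "nat \<Rightarrow> real"
  assumes S: "S \<in> sets borel" "S \<subseteq> {0..R}"
    and \<mu>: "\<And>i. i < n \<Longrightarrow> \<mu> i \<le> R" and \<nu>: "\<And>j. j < k \<Longrightarrow> 0 \<le> \<nu> j"
    and le: "\<And>z. card {j. j < k \<and> \<nu> j < z} \<le> card {i. i < n \<and> \<mu> i \<le> z}"
    and less: "\<And>z. z \<in> S \<Longrightarrow> card {j. j < k \<and> \<nu> j < z} < card {i. i < n \<and> \<mu> i \<le> z}"
  shows "measure lborel S \<le> (\<Sum>i<n. R - \<mu> i) - (\<Sum>j<k. R - \<nu> j)"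
proof -
  have count: "(\<Sum>i<l. indicator (A i) z) = real (card {i. i < l \<and> z \<in> A i})"
    for l and A :: "nat \<Rightarrow> real set" and z
  proof -
    have "(\<Sum>i<l. indicator (A i) z :: real) = (\<Sum>i<l. if i \<in> {i. z \<in> A i} then 1 else 0)"
      by (intro sum.cong) (auto simp: indicator_def)
    also have "\<dots> = (\<Sum>i\<in>{..<l} \<inter> {i. z \<in> A i}. 1)"
      by (rule sum.inter_restrict[symmetric]) simp
    also have "{..<l} \<inter> {i. z \<in> A i} = {i. i < l \<and> z \<in> A i}" by auto
    finally show ?thesis by simp
  qed
  \<comment> \<open>For z \<le> R, closed intervals for \<mu> and left-open ones for \<nu> reproduce
    exactly the nonstrict and the strict count. Above R every indicator is 0.\<close>
  have pointwise: "indicator S z + (\<Sum>j<k. indicator {\<nu> j<..R} z) \<le> (\<Sum>i<n. indicator {\<mu> i..R} z :: real)" for z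
  proof (cases "z \<le> R")
    case True
    have "indicator S z + real (card {j. j < k \<and> \<nu> j < z}) \<le> real (card {i. i < n \<and> \<mu> i \<le> z})"
      using le[of z] less[of z] by (cases "z \<in> S") auto
    with True show ?thesis
      by (simp add: count)
  next
    case False
    then have "z \<notin> S" using S(2) by auto
    with False show ?thesis by (simp add: count)
  qed
  have "emeasure lborel S \<le> emeasure lborel {0..R}"
    using S(2) by (intro emeasure_mono) auto
  then have finS: "emeasure lborel S < \<infinity>"
    by (rule le_less_trans) (simp add: emeasure_lborel_Icc_eq)
  have int: "integrable lborel (\<lambda>z. indicator S z :: real)"
    "integrable lborel (\<lambda>z. indicator {\<nu> j<..R} z :: real)"
    "integrable lborel (\<lambda>z. indicator {\<mu> i..R} z :: real)" for i j
    using S finS by (auto intro!: integrable_real_indicator emeasure_bounded_finite)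
  have "(\<integral>z. indicator S z + (\<Sum>j<k. indicator {\<nu> j<..R} z) \<partial>lborel) \<le>
      (\<integral>z. (\<Sum>i<n. indicator {\<mu> i..R} z :: real) \<partial>lborel)"
    by (intro integral_mono pointwise Bochner_Integration.integrable_add Bochner_Integration.integrable_sum int)
  then have "measure lborel S + (\<Sum>j<k. measure lborel {\<nu> j<..R}) \<le> (\<Sum>i<n. measure lborel {\<mu> i..R})"
    using int by (simp add: Bochner_Integration.integral_sum)
  \<comment> \<open>Only an inequality: if \<nu> exceeds R, its interval is empty while the summand
    on the left is negative.\<close>
  moreover have "(\<Sum>j<k. R - \<nu> j) \<le> (\<Sum>j<k. measure lborel {\<nu> j<..R})"
  proof (intro sum_mono)
    show "R - \<nu> j \<le> measure lborel {\<nu> j<..R}" for j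
      by (cases "\<nu> j \<le> R") (simp_all add: order_trans[OF _ measure_nonneg])
  qed
  moreover have "(\<Sum>i<n. measure lborel {\<mu> i..R}) = (\<Sum>i<n. R - \<mu> i)"
    using \<mu> by (intro sum.cong) auto
  ultimately show ?thesis by linarith
qed

section \<open>Magnetic forms\<close>

text \<open>Injectivity implies surjectivity by counting: a target \<open>g\<close> and the images
  of the point masses are dependent, and the coefficient of \<open>g\<close> is nonzero, since
  otherwise the relation would give a kernel vector.\<close>

lemma op_spectrum_eigenvector_iff:
  fixes T :: "('x \<Rightarrow> complex) \<Rightarrow> 'x \<Rightarrow> complex"
  assumes "finite X" and maps: "\<And>f. T f \<in> ell2 X"
    and add: "\<And>f g. T (\<lambda>x. f x + g x) = (\<lambda>x. T f x + T g x)"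
    and scale: "\<And>c f. T (\<lambda>x. c * f x) = (\<lambda>x. c * T f x)"
  shows "z \<in> op_spectrum (ell2 X) T \<longleftrightarrow> (\<exists>f\<in>ell2 X. f \<noteq> (\<lambda>_. 0) \<and> T f = (\<lambda>x. z * f x))"
proof -
  define S where "S f = (\<lambda>x. T f x - z * f x)" for f
  have S_add: "S (\<lambda>x. f x + g x) = (\<lambda>x. S f x + S g x)" for f g
    by (simp add: S_def add fun_eq_iff algebra_simps)
  have S_scale: "S (\<lambda>x. c * f x) = (\<lambda>x. c * S f x)" for c f
    by (simp add: S_def scale fun_eq_iff algebra_simps)
  have S_0: "S (\<lambda>_. 0) = (\<lambda>_. 0)"
    using S_scale[of 0 "\<lambda>_. 0"] by simp
  have S_maps: "S f \<in> ell2 X" if "f \<in> ell2 X" for f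
    using maps[of f] that by (simp add: S_def ell2_def)
  have S_sum: "S (\<lambda>x. \<Sum>i\<in>I. c i * f i x) = (\<lambda>x. \<Sum>i\<in>I. c i * S (f i) x)"
    for I :: "'x set" and c :: "'x \<Rightarrow> complex" and f :: "'x \<Rightarrow> 'x \<Rightarrow> complex"
    by (induction I rule: infinite_finite_induct) (simp_all add: S_0 S_add S_scale)
  have "bij_betw S (ell2 X) (ell2 X) \<longleftrightarrow> (\<forall>f\<in>ell2 X. S f = (\<lambda>_. 0) \<longrightarrow> f = (\<lambda>_. 0))"
  proof
    assume "bij_betw S (ell2 X) (ell2 X)"
    then have "inj_on S (ell2 X)" by (rule bij_betw_imp_inj_on)
    moreover have "(\<lambda>_. 0) \<in> ell2 X" by (simp add: ell2_def)
    ultimately show "\<forall>f\<in>ell2 X. S f = (\<lambda>_. 0) \<longrightarrow> f = (\<lambda>_. 0)"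
      using S_0 by (metis inj_onD)
  next
    assume ker: "\<forall>f\<in>ell2 X. S f = (\<lambda>_. 0) \<longrightarrow> f = (\<lambda>_. 0)"
    have "inj_on S (ell2 X)"
    proof
      fix f g assume fg: "f \<in> ell2 X" "g \<in> ell2 X" "S f = S g"
      have "S (\<lambda>x. f x + (- 1) * g x) = (\<lambda>_. 0)"
        unfolding S_add S_scale using fg(3) by simp
      moreover have "(\<lambda>x. f x + (- 1) * g x) \<in> ell2 X"
        using fg by (simp add: ell2_def)
      ultimately have "(\<lambda>x. f x + (- 1) * g x) = (\<lambda>_. 0)"
        using ker by blast
      then show "f = g" by (simp add: fun_eq_iff)
    qed
    moreover have "g \<in> S ` ell2 X" if g: "g \<in> ell2 X" for g
    proof -
      \<comment> \<open>\<open>None\<close> indexes the target, \<open>Some y\<close> the image of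
        the point mass at \<open>y\<close>.\<close>
      define a where "a i x = (case i of None \<Rightarrow> g x | Some y \<Rightarrow> S (\<lambda>w. of_bool (w = y)) x)" for i x
      have "card X < card (insert None (Some ` X))"
        using \<open>finite X\<close> by (simp add: card_image)
      then obtain c where c: "\<exists>i\<in>insert None (Some ` X). c i \<noteq> 0"
        "\<And>x. x \<in> X \<Longrightarrow> (\<Sum>i\<in>insert None (Some ` X). c i * a i x) = 0"
        using homogeneous_system_nontrivial[of X "insert None (Some ` X)" a] \<open>finite X\<close> by auto
      define u where "u = (\<lambda>w. \<Sum>y\<in>X. c (Some y) * of_bool (w = y))"
      have uX: "u \<in> ell2 X"
        unfolding u_def by (rule ell2_sum) (rule ell2_delta)
      have u_val: "u y = c (Some y)" if "y \<in> X" for y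
      proof -
        have "u y = (\<Sum>w\<in>X. if y = w then c (Some w) else 0)"
          unfolding u_def by (intro sum.cong) auto
        then show ?thesis using \<open>finite X\<close> that by simp
      qed
      have Su: "c None * g x + S u x = 0" for x
      proof (cases "x \<in> X")
        case True
        with c(2)[OF True] \<open>finite X\<close> show ?thesis
          unfolding u_def S_sum by (simp add: sum.reindex a_def)
      next
        case False
        with g S_maps[OF uX] show ?thesis by (simp add: ell2_def)
      qed
      have "c None \<noteq> 0"
      proof
        assume 0: "c None = 0"
        with Su have "S u = (\<lambda>_. 0)" by (simp add: fun_eq_iff)
        with ker uX have "u = (\<lambda>_. 0)" by blast
        with u_val c(1) 0 show False by (auto simp: fun_eq_iff)
      qed
      define f where "f = (\<lambda>x. (- 1 / c None) * u x)"
      have "S f x = g x" for x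
        unfolding f_def S_scale using Su[of x] \<open>c None \<noteq> 0\<close> by (simp add: field_simps add_eq_0_iff)
      moreover have "f \<in> ell2 X"
        using uX by (simp add: f_def ell2_def)
      ultimately show ?thesis by (intro image_eqI[of _ _ f]) auto
    qed
    ultimately show "bij_betw S (ell2 X) (ell2 X)"
      using S_maps by (auto simp: bij_betw_def)
  qed
  moreover have "S f = (\<lambda>_. 0) \<longleftrightarrow> T f = (\<lambda>x. z * f x)" for f
    by (simp add: S_def fun_eq_iff)
  moreover have "z \<in> op_spectrum (ell2 X) T \<longleftrightarrow> \<not> bij_betw S (ell2 X) (ell2 X)"
    by (simp add: op_spectrum_def S_def[abs_def])
  ultimately show ?thesis by blast
qed

section \<open>The magnetic differential, its quadratic form and its Laplacian\<close>

lemma magnetic_d_add: "magnetic_d G \<alpha> (\<lambda>x. f x + g x) e = magnetic_d G \<alpha> f e + magnetic_d G \<alpha> g e"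
  by (simp add: magnetic_d_def algebra_simps)

lemma magnetic_d_scale: "magnetic_d G \<alpha> (\<lambda>x. c * f x) e = c * magnetic_d G \<alpha> f e"
  by (simp add: magnetic_d_def algebra_simps)

text \<open>Because of the half-angles, the phases at the two ends combine into a common factor with
  the mean of \<theta>. It depends on the edge alone and cancels in the form.\<close>

lemma magnetic_d_gauge:
  assumes "e \<in> arcs G"
  shows "magnetic_d G \<alpha> (\<lambda>v. exp (\<i> * of_real (\<theta> v)) * f v) e =
    exp (\<i> * of_real ((\<theta> (head G e) + \<theta> (tail G e)) / 2)) *
    magnetic_d G (\<lambda>e. \<alpha> e + \<theta> (head G e) - \<theta> (tail G e)) f e"
proof -
  let ?\<alpha>' = "\<lambda>e. \<alpha> e + \<theta> (head G e) - \<theta> (tail G e)"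
  let ?c = "exp (\<i> * of_real ((\<theta> (head G e) + \<theta> (tail G e)) / 2))"
  have "exp (\<i> * of_real (\<alpha> e) / 2) * exp (\<i> * of_real (\<theta> (head G e))) = ?c * exp (\<i> * of_real (?\<alpha>' e) / 2)"
    "exp (- \<i> * of_real (\<alpha> e) / 2) * exp (\<i> * of_real (\<theta> (tail G e))) = ?c * exp (- \<i> * of_real (?\<alpha>' e) / 2)"
    unfolding exp_add[symmetric] by (rule arg_cong[of _ _ exp], simp add: field_simps)+
  with assms show ?thesis
    by (simp add: magnetic_d_def right_diff_distrib mult.assoc[symmetric])
qed

lemma continuous_on_magnetic_d:
  assumes "\<And>e. continuous_on S (\<lambda>p. a p e)" "\<And>v. continuous_on S (\<lambda>p. u p v)"
  shows "continuous_on S (\<lambda>p. magnetic_d G (a p) (u p) e)"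
  using assms by (cases "e \<in> arcs G") (simp_all add: magnetic_d_def continuous_intros)

lemma exp_ii_mult_cnj_cancel:
  "(exp (\<i> * complex_of_real t) * x) * cnj (exp (\<i> * complex_of_real t) * y) = x * cnj y"
proof -
  let ?c = "exp (\<i> * complex_of_real t)"
  have "?c * cnj ?c = 1"
    by (simp only: complex_norm_square[symmetric] norm_exp_i_times) simp
  moreover have "(?c * x) * cnj (?c * y) = (?c * cnj ?c) * (x * cnj y)"
    by (simp only: complex_cnj_mult mult_ac)
  ultimately show ?thesis by simp
qed

lemma norm_magnetic_d_eq:
  assumes "e \<in> arcs G" "\<alpha> e = \<beta> e \<or> u (head G e) = 0 \<or> u (tail G e) = 0"
  shows "cmod (magnetic_d G \<alpha> u e) = cmod (magnetic_d G \<beta> u e)"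
  using assms by (auto simp: magnetic_d_def norm_mult)

context finite_weighted_graph
begin

text \<open>Keeping \<open>F\<close> separate from \<open>G\<close> lets the graph without the cycle
  edges share \<open>magnetic_d G\<close> with the full graph.\<close>

abbreviation magnetic_form ::
  "'e set \<Rightarrow> ('e \<Rightarrow> real) \<Rightarrow> ('v \<Rightarrow> complex) \<Rightarrow> ('v \<Rightarrow> complex) \<Rightarrow> complex" where
  "magnetic_form F \<alpha> f g \<equiv> ell2_inner F mE (magnetic_d G \<alpha> f) (magnetic_d G \<alpha> g)"

lemma hermitian_form_magnetic: "hermitian_form (magnetic_form F \<alpha>)"
  by (rule hermitian_form_ell2_inner) (simp_all add: magnetic_d_add magnetic_d_scale)

lemma continuous_magnetic_form: "continuous_on UNIV (\<lambda>f. magnetic_form F \<alpha> f f)"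
  unfolding ell2_inner_def
  by (intro continuous_intros continuous_on_magnetic_d continuous_on_product_coordinates)

text \<open>The functional defining the adjoint is determined by its values on point masses. The
  resulting formula holds for every \<open>f\<close>, and gives linearity, vanishing off the
  vertices, and joint continuity in potential and function.\<close>

lemma magnetic_laplacian_form:
  "magnetic_laplacian G mV mE \<alpha> f =
    (\<lambda>x. if x \<in> verts G then magnetic_form (arcs G) \<alpha> f (\<lambda>y. of_bool (y = x)) / of_real (mV x) else 0)"
  (is "_ = ?h")
  and magnetic_laplacian_inner:
  "g \<in> ell2 (verts G) \<Longrightarrow>
    ell2_inner (verts G) mV g (magnetic_laplacian G mV mE \<alpha> f) = magnetic_form (arcs G) \<alpha> g f"
proof -
  interpret q: hermitian_form "magnetic_form (arcs G) \<alpha>" by (rule hermitian_form_magnetic)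
  have mem: "?h \<in> ell2 (verts G)" by (simp add: ell2_def)
  have inner: "magnetic_form (arcs G) \<alpha> g f = ell2_inner (verts G) mV g ?h" if "g \<in> ell2 (verts G)" for g
  proof -
    have "magnetic_form (arcs G) \<alpha> g f = (\<Sum>x\<in>verts G. g x * magnetic_form (arcs G) \<alpha> (\<lambda>y. of_bool (y = x)) f)"
      by (subst ell2_eq_sum_delta[OF finite_verts that]) (rule q.sum_left)
    also have "\<dots> = ell2_inner (verts G) mV g ?h"
      unfolding ell2_inner_def[of "verts G"]
    proof (intro sum.cong refl)
      fix x assume x: "x \<in> verts G"
      then show "g x * magnetic_form (arcs G) \<alpha> (\<lambda>y. of_bool (y = x)) f = g x * cnj (?h x) * of_real (mV x)"
        using mV_pos[OF x] by (subst q.herm) simp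
    qed
    finally show ?thesis .
  qed
  show eq: "magnetic_laplacian G mV mE \<alpha> f = ?h"
    unfolding magnetic_laplacian_def ell2_adjoint_def
  proof (rule the_equality)
    show "h = ?h" if "h \<in> ell2 (verts G) \<and>
      (\<forall>g\<in>ell2 (verts G). magnetic_form (arcs G) \<alpha> g f = ell2_inner (verts G) mV g h)" for h
      by (rule ell2_inner_left_cancel[where m = mV, OF finite_verts mV_pos])
        (use that mem inner in auto)
  qed (use mem inner in blast)
  show "ell2_inner (verts G) mV g (magnetic_laplacian G mV mE \<alpha> f) = magnetic_form (arcs G) \<alpha> g f"
    if "g \<in> ell2 (verts G)"
    unfolding eq inner[OF that] ..
qed

lemma magnetic_laplacian_add:
  "magnetic_laplacian G mV mE \<alpha> (\<lambda>x. f x + g x) =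
    (\<lambda>x. magnetic_laplacian G mV mE \<alpha> f x + magnetic_laplacian G mV mE \<alpha> g x)"
proof -
  interpret q: hermitian_form "magnetic_form (arcs G) \<alpha>" by (rule hermitian_form_magnetic)
  show ?thesis
    by (simp add: magnetic_laplacian_form q.add_left add_divide_distrib fun_eq_iff)
qed

lemma magnetic_laplacian_scale:
  "magnetic_laplacian G mV mE \<alpha> (\<lambda>x. c * f x) = (\<lambda>x. c * magnetic_laplacian G mV mE \<alpha> f x)"
proof -
  interpret q: hermitian_form "magnetic_form (arcs G) \<alpha>" by (rule hermitian_form_magnetic)
  show ?thesis
    by (simp add: magnetic_laplacian_form q.scale_left fun_eq_iff)
qed

lemma magnetic_laplacian_spectrum_iff:
  "z \<in> op_spectrum (ell2 (verts G)) (magnetic_laplacian G mV mE \<alpha>) \<longleftrightarrow>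
    (\<exists>f\<in>ell2 (verts G). f \<noteq> (\<lambda>_. 0) \<and> magnetic_laplacian G mV mE \<alpha> f = (\<lambda>x. z * f x))"
  by (rule op_spectrum_eigenvector_iff)
    (simp_all add: magnetic_laplacian_add magnetic_laplacian_scale, simp add: magnetic_laplacian_form ell2_def)

text \<open>
  The union is uncountable, so its measurability is not automatic; without it, \<^const>\<open>measure\<close> of
  the gaps would be \<open>0\<close> by convention.
\<close>

lemma compact_magnetic_spectra:
  "compact ({0..R} \<inter> (\<Union>\<alpha>. complex_of_real -` op_spectrum (ell2 (verts G)) (magnetic_laplacian G mV mE \<alpha>)))"
    (is "compact ?S")
proof -
  let ?L = "\<lambda>p :: real \<times> ('v \<Rightarrow> complex) \<times> ('e \<Rightarrow> real). magnetic_laplacian G mV mE (snd (snd p)) (fst (snd p))"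
  \<comment> \<open>The spectra are the first projection of a closed set of triples (eigenvalue,
    unit eigenvector, potential) inside this compact set. Reducing potentials modulo 2 pi and
    setting them to 0 off the edges loses nothing, by
    \<open>magnetic_laplacian_cong\<close>.\<close>
  define B where "B = {0..R} \<times> {f \<in> ell2 (verts G). ell2_inner (verts G) mV f f = 1} \<times>
    Pi\<^sub>E UNIV (\<lambda>e. if e \<in> arcs G then {0..2 * pi} else {0})"
  define C where "C = B \<inter> (\<Inter>x\<in>verts G. {p. ?L p x = of_real (fst p) * fst (snd p) x})"
  have "compact B"
    unfolding B_def using mV_pos
    by (intro compact_Times compact_PiE_UNIV compact_ell2_sphere) auto
  moreover have "closed {p. ?L p x = of_real (fst p) * fst (snd p) x}" if x: "x \<in> verts G" for x
  proof -
    have eval: "continuous_on UNIV (\<lambda>p :: real \<times> ('v \<Rightarrow> complex) \<times> ('e \<Rightarrow> real). fst (snd p) y)" for y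
      by (intro continuous_on_product_then_coordinatewise[where f = "\<lambda>p. fst (snd p)"] continuous_intros)
    have "continuous_on UNIV (\<lambda>p :: real \<times> ('v \<Rightarrow> complex) \<times> ('e \<Rightarrow> real). snd (snd p) e)" for e
      by (intro continuous_on_product_then_coordinatewise[where f = "\<lambda>p. snd (snd p)"] continuous_intros)
    with eval have "continuous_on UNIV (\<lambda>p. ?L p x)"
      using x mV_pos[OF x] unfolding magnetic_laplacian_form ell2_inner_def
      by (auto intro!: continuous_intros continuous_on_magnetic_d)
    then show ?thesis
      by (rule closed_Collect_eq) (intro continuous_intros eval)
  qed
  ultimately have "compact C"
    unfolding C_def by (intro compact_Int_closed closed_INT) auto
  then have "compact (fst ` C)"
    by (intro compact_continuous_image continuous_intros)
  moreover have "fst ` C = ?S"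
  proof (intro equalityI subsetI)
    fix z assume "z \<in> fst ` C"
    then obtain f \<alpha> where *: "0 \<le> z" "z \<le> R" "f \<in> ell2 (verts G)" "ell2_inner (verts G) mV f f = 1"
      "\<forall>x\<in>verts G. magnetic_laplacian G mV mE \<alpha> f x = of_real z * f x"
      by (auto simp: C_def B_def)
    have "f \<noteq> (\<lambda>_. 0)"
      using *(4) by (auto simp: ell2_inner_def)
    moreover have "magnetic_laplacian G mV mE \<alpha> f = (\<lambda>x. of_real z * f x)"
    proof
      fix x
      show "magnetic_laplacian G mV mE \<alpha> f x = of_real z * f x"
        using *(3,5) by (cases "x \<in> verts G") (simp_all add: magnetic_laplacian_form ell2_def)
    qed
    ultimately have "of_real z \<in> op_spectrum (ell2 (verts G)) (magnetic_laplacian G mV mE \<alpha>)"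
      using *(3) unfolding magnetic_laplacian_spectrum_iff by blast
    with *(1,2) show "z \<in> ?S" by auto
  next
    fix z assume "z \<in> ?S"
    then obtain \<alpha> f where *: "0 \<le> z" "z \<le> R" "f \<in> ell2 (verts G)" "f \<noteq> (\<lambda>_. 0)"
      and eig: "magnetic_laplacian G mV mE \<alpha> f = (\<lambda>x. of_real z * f x)"
      by (auto simp: magnetic_laplacian_spectrum_iff)
    obtain s :: real where "0 < s"
      and s: "ell2_inner (verts G) mV (\<lambda>x. of_real s * f x) (\<lambda>x. of_real s * f x) = 1"
      by (rule ell2_normalize[where m = mV, OF _ _ *(3,4)]) (use mV_pos in auto)
    define \<beta> where "\<beta> e = (if e \<in> arcs G then \<alpha> e - 2 * pi * \<lfloor>\<alpha> e / (2 * pi)\<rfloor> else 0)" for e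
    have "0 \<le> \<beta> e \<and> \<beta> e \<le> 2 * pi" for e
      using floor_divide_lower[of "2 * pi" "\<alpha> e"] floor_divide_upper[of "2 * pi" "\<alpha> e"] pi_gt_zero
      by (simp add: \<beta>_def algebra_simps)
    moreover have "\<beta> e = 0" if "e \<notin> arcs G" for e
      using that by (simp add: \<beta>_def)
    ultimately have "(z, (\<lambda>x. of_real s * f x), \<beta>) \<in> B"
      using * s by (auto simp: B_def ell2_def)
    moreover have "\<exists>k::int. \<beta> e - \<alpha> e = 2 * pi * of_int k" if "e \<in> arcs G" for e
      using that by (intro exI[of _ "- \<lfloor>\<alpha> e / (2 * pi)\<rfloor>"]) (simp add: \<beta>_def)
    then have "magnetic_laplacian G mV mE \<beta> = magnetic_laplacian G mV mE \<alpha>"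
      by (rule magnetic_laplacian_cong)
    then have "magnetic_laplacian G mV mE \<beta> (\<lambda>x. of_real s * f x) x = of_real z * (of_real s * f x)" for x
      using fun_cong[OF eig, of x] magnetic_laplacian_scale[of \<alpha> "of_real s" f] by (simp add: mult_ac)
    ultimately have "(z, (\<lambda>x. of_real s * f x), \<beta>) \<in> C"
      by (simp add: C_def)
    then show "z \<in> fst ` C" by force
  qed
  ultimately show ?thesis by simp
qed

section \<open>Bounds for magnetic forms, gauge invariance and the trace\<close>

lemma magnetic_form_self:
  "magnetic_form F \<alpha> f f = of_real (\<Sum>e\<in>F. (cmod (magnetic_d G \<alpha> f e))\<^sup>2 * mE e)"
  by (rule ell2_inner_self)

lemma rel_weight_le_max: "v \<in> verts G \<Longrightarrow> rel_weight G mV mE v \<le> max_rel_weight G mV mE"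
  by (simp add: max_rel_weight_def)

lemma sum_arcs_ends:
  fixes \<phi> :: "'v \<Rightarrow> real"
  shows "(\<Sum>e\<in>arcs G. (\<phi> (head G e) + \<phi> (tail G e)) * mE e) =
    (\<Sum>v\<in>verts G. \<phi> v * (rel_weight G mV mE v * mV v))"
proof -
  have "(\<Sum>e\<in>arcs G. \<phi> (head G e) * mE e) = (\<Sum>v\<in>verts G. \<Sum>e\<in>in_arcs G v. \<phi> (head G e) * mE e)"
    unfolding in_arcs_def by (rule sum.group[symmetric]) auto
  moreover have "(\<Sum>e\<in>arcs G. \<phi> (tail G e) * mE e) = (\<Sum>v\<in>verts G. \<Sum>e\<in>out_arcs G v. \<phi> (tail G e) * mE e)"
    unfolding out_arcs_def by (rule sum.group[symmetric]) auto
  moreover have "(\<Sum>e\<in>in_arcs G v. \<phi> (head G e) * mE e) + (\<Sum>e\<in>out_arcs G v. \<phi> (tail G e) * mE e) =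
      \<phi> v * (rel_weight G mV mE v * mV v)" if "v \<in> verts G" for v
    using mV_pos[OF that] by (simp add: rel_weight_def distrib_left sum_distrib_left)
  ultimately have "(\<Sum>e\<in>arcs G. \<phi> (head G e) * mE e) + (\<Sum>e\<in>arcs G. \<phi> (tail G e) * mE e) =
      (\<Sum>v\<in>verts G. \<phi> v * (rel_weight G mV mE v * mV v))"
    by (simp flip: sum.distrib)
  then show ?thesis
    by (simp add: distrib_right sum.distrib)
qed

text \<open>On each edge |a - b|^2 \<le> 2|a|^2 + 2|b|^2, and \<open>sum_arcs_ends\<close> regroups
  the right side by vertices. This is the origin of the factor 2 in the upper end of the spectral
  window.\<close>

lemma magnetic_form_le:
  assumes "F \<subseteq> arcs G"
  shows "Re (magnetic_form F \<alpha> f f) \<le> 2 * max_rel_weight G mV mE * Re (ell2_inner (verts G) mV f f)"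
proof -
  have "Re (magnetic_form F \<alpha> f f) \<le> (\<Sum>e\<in>arcs G. (cmod (magnetic_d G \<alpha> f e))\<^sup>2 * mE e)"
    unfolding magnetic_form_self Re_complex_of_real
    by (intro sum_mono2) (use assms mE_pos in \<open>auto simp: less_imp_le\<close>)
  also have "\<dots> \<le> (\<Sum>e\<in>arcs G. (2 * (cmod (f (head G e)))\<^sup>2 + 2 * (cmod (f (tail G e)))\<^sup>2) * mE e)"
  proof (intro sum_mono mult_right_mono)
    fix e assume e: "e \<in> arcs G"
    have "cmod (magnetic_d G \<alpha> f e) \<le> cmod (f (head G e)) + cmod (f (tail G e))"
      using e norm_triangle_ineq4[of "exp (\<i> * complex_of_real (\<alpha> e) / 2) * f (head G e)"
          "exp (- \<i> * complex_of_real (\<alpha> e) / 2) * f (tail G e)"]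
      by (simp add: magnetic_d_def norm_mult)
    then have "(cmod (magnetic_d G \<alpha> f e))\<^sup>2 \<le> (cmod (f (head G e)) + cmod (f (tail G e)))\<^sup>2"
      by (rule power_mono) simp
    also have "\<dots> \<le> 2 * (cmod (f (head G e)))\<^sup>2 + 2 * (cmod (f (tail G e)))\<^sup>2"
      using sum_squares_bound[of "cmod (f (head G e))" "cmod (f (tail G e))"]
      by (simp add: power2_sum)
    finally show "(cmod (magnetic_d G \<alpha> f e))\<^sup>2 \<le> 2 * (cmod (f (head G e)))\<^sup>2 + 2 * (cmod (f (tail G e)))\<^sup>2" .
    show "0 \<le> mE e" using mE_pos[OF e] by simp
  qed
  also have "\<dots> = (\<Sum>v\<in>verts G. 2 * (cmod (f v))\<^sup>2 * (rel_weight G mV mE v * mV v))"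
    by (rule sum_arcs_ends)
  also have "\<dots> \<le> (\<Sum>v\<in>verts G. 2 * (cmod (f v))\<^sup>2 * (max_rel_weight G mV mE * mV v))"
    using mV_pos by (intro sum_mono mult_left_mono mult_right_mono rel_weight_le_max) (auto simp: less_imp_le)
  also have "\<dots> = 2 * max_rel_weight G mV mE * Re (ell2_inner (verts G) mV f f)"
    unfolding ell2_inner_self by (simp add: sum_distrib_left mult_ac)
  finally show ?thesis .
qed

lemma magnetic_form_nonneg:
  assumes "F \<subseteq> arcs G"
  shows "0 \<le> Re (magnetic_form F \<alpha> f f)"
  unfolding magnetic_form_self Re_complex_of_real
  by (intro sum_nonneg) (use assms mE_pos in \<open>auto simp: less_imp_le subset_iff\<close>)

text \<open>The inequality of truth values is an exclusive or: at zero potential the two terms of a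
  loop cancel, so loops contribute nothing.\<close>

lemma magnetic_form_delta:
  assumes "F \<subseteq> arcs G"
  shows "Re (magnetic_form F (\<lambda>_. 0) (\<lambda>y. of_bool (y = v)) (\<lambda>y. of_bool (y = v))) =
    (\<Sum>e\<in>F. of_bool ((head G e = v) \<noteq> (tail G e = v)) * mE e)"
  unfolding magnetic_form_self Re_complex_of_real
  by (intro sum.cong) (use assms in \<open>auto simp: magnetic_d_def subset_iff\<close>)

lemma magnetic_form_gauge:
  "magnetic_form (arcs G) \<alpha> (\<lambda>v. exp (\<i> * of_real (\<theta> v)) * f v) (\<lambda>v. exp (\<i> * of_real (\<theta> v)) * g v) =
    magnetic_form (arcs G) (\<lambda>e. \<alpha> e + \<theta> (head G e) - \<theta> (tail G e)) f g"
  unfolding ell2_inner_def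
proof (intro sum.cong refl)
  fix e assume e: "e \<in> arcs G"
  show "magnetic_d G \<alpha> (\<lambda>v. exp (\<i> * of_real (\<theta> v)) * f v) e *
      cnj (magnetic_d G \<alpha> (\<lambda>v. exp (\<i> * of_real (\<theta> v)) * g v) e) * of_real (mE e) =
    magnetic_d G (\<lambda>e. \<alpha> e + \<theta> (head G e) - \<theta> (tail G e)) f e *
      cnj (magnetic_d G (\<lambda>e. \<alpha> e + \<theta> (head G e) - \<theta> (tail G e)) g e) * of_real (mE e)"
    unfolding magnetic_d_gauge[OF e] by (simp only: exp_ii_mult_cnj_cancel)
qed

text \<open>Multiplication by exp(-i \<theta>) carries the eigenvector over. The conclusion is in
  weak form, as \<open>eigenvalue_bracketing\<close> consumes it.\<close>

lemma magnetic_eigenvector_gauge: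
  assumes "\<exists>f\<in>ell2 (verts G). f \<noteq> (\<lambda>_. 0) \<and> magnetic_laplacian G mV mE \<alpha> f = (\<lambda>x. of_real z * f x)"
  shows "\<exists>f\<in>ell2 (verts G). f \<noteq> (\<lambda>_. 0) \<and> (\<forall>g\<in>ell2 (verts G).
    magnetic_form (arcs G) (\<lambda>e. \<alpha> e + \<theta> (head G e) - \<theta> (tail G e)) g f = of_real z * ell2_inner (verts G) mV g f)"
proof -
  interpret inn: hermitian_form "ell2_inner (verts G) mV" by (rule hermitian_form_inner)
  let ?U = "\<lambda>f v. exp (\<i> * complex_of_real (\<theta> v)) * f v"
  obtain f where f: "f \<in> ell2 (verts G)" "f \<noteq> (\<lambda>_. 0)"
    and eig: "magnetic_laplacian G mV mE \<alpha> f = (\<lambda>x. of_real z * f x)"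
    using assms by blast
  define f' where "f' v = exp (- \<i> * complex_of_real (\<theta> v)) * f v" for v
  have Uf': "?U f' = f"
    by (simp add: f'_def fun_eq_iff mult.assoc[symmetric] exp_add[symmetric])
  have U_inner: "ell2_inner (verts G) mV (?U g) (?U h) = ell2_inner (verts G) mV g h" for g h
    unfolding ell2_inner_def
    by (simp only: exp_ii_mult_cnj_cancel)
  have "magnetic_form (arcs G) (\<lambda>e. \<alpha> e + \<theta> (head G e) - \<theta> (tail G e)) g f' = of_real z * ell2_inner (verts G) mV g f'"
    if "g \<in> ell2 (verts G)" for g
  proof -
    have "?U g \<in> ell2 (verts G)"
      using that by (simp add: ell2_def)
    then have "magnetic_form (arcs G) \<alpha> (?U g) f = of_real z * ell2_inner (verts G) mV (?U g) f"
      by (simp add: magnetic_laplacian_inner[symmetric] eig inn.scale_right)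
    then show ?thesis
      using magnetic_form_gauge[of \<alpha> \<theta> g f'] U_inner[of g f'] unfolding Uf' by simp
  qed
  moreover have "f' \<in> ell2 (verts G)"
    using f by (simp add: ell2_def f'_def)
  moreover have "f' \<noteq> (\<lambda>_. 0)"
    using f(2) by (auto simp: f'_def fun_eq_iff)
  ultimately show ?thesis by blast
qed

lemma magnetic_form_tree_le:
  assumes "F \<subseteq> arcs G" "\<And>e. e \<in> F \<Longrightarrow> \<alpha> e = 0"
  shows "Re (magnetic_form F (\<lambda>_. 0) u u) \<le> Re (magnetic_form (arcs G) \<alpha> u u)"
proof -
  have "Re (magnetic_form F (\<lambda>_. 0) u u) = (\<Sum>e\<in>F. (cmod (magnetic_d G \<alpha> u e))\<^sup>2 * mE e)"
    unfolding magnetic_form_self Re_complex_of_real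
  proof (intro sum.cong refl)
    fix e assume "e \<in> F"
    with assms have "cmod (magnetic_d G (\<lambda>_. 0) u e) = cmod (magnetic_d G \<alpha> u e)"
      by (intro norm_magnetic_d_eq) auto
    then show "(cmod (magnetic_d G (\<lambda>_. 0) u e))\<^sup>2 * mE e = (cmod (magnetic_d G \<alpha> u e))\<^sup>2 * mE e"
      by simp
  qed
  also have "\<dots> \<le> Re (magnetic_form (arcs G) \<alpha> u u)"
    unfolding magnetic_form_self Re_complex_of_real
    by (intro sum_mono2) (use assms(1) mE_pos in \<open>auto simp: less_imp_le\<close>)
  finally show ?thesis .
qed

lemma magnetic_form_Dirichlet_eq:
  assumes "A \<subseteq> in_arcs G v \<union> out_arcs G v" "\<And>e. e \<in> arcs G - A \<Longrightarrow> \<alpha> e = 0" "u v = 0"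
  shows "magnetic_form (arcs G) \<alpha> u u = magnetic_form (arcs G) (\<lambda>_. 0) u u"
proof -
  have "cmod (magnetic_d G \<alpha> u e) = cmod (magnetic_d G (\<lambda>_. 0) u e)" if "e \<in> arcs G" for e
  proof (rule norm_magnetic_d_eq[OF that])
    show "\<alpha> e = 0 \<or> u (head G e) = 0 \<or> u (tail G e) = 0"
      using that assms by (cases "e \<in> A") auto
  qed
  then show ?thesis
    by (simp add: magnetic_form_self)
qed

text \<open>Away from \<open>v\<close> the two diagonals differ only by the edges of
  \<open>A\<close>, each seen at its other end; at \<open>v\<close> only the edges off
  \<open>A\<close> remain. A loop in \<open>A\<close> enters neither trace but counts twice in the
  relative weight; the two subtracted sums each remove it once, because its other end is
  \<open>v\<close>.\<close>

lemma trace_difference: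
  assumes v: "v \<in> verts G" and A: "A \<subseteq> in_arcs G v \<union> out_arcs G v"
    and noloop: "\<And>e. e \<in> arcs G - A \<Longrightarrow> tail G e \<noteq> head G e"
  shows "(\<Sum>x\<in>verts G. (\<Sum>e\<in>arcs G - A. of_bool ((head G e = x) \<noteq> (tail G e = x)) * mE e) / mV x) -
      (\<Sum>x\<in>verts G - {v}. (\<Sum>e\<in>arcs G. of_bool ((head G e = x) \<noteq> (tail G e = x)) * mE e) / mV x) =
    rel_weight G mV mE v - (\<Sum>e\<in>A. mE e / mV (other_end G v e)) - sum mE A / mV v"
proof -
  let ?k = "\<lambda>e x. of_bool ((head G e = x) \<noteq> (tail G e = x)) * mE e"
  let ?o = "other_end G v"
  have AE: "A \<subseteq> arcs G" using A by auto
  then have finA: "finite A" by (rule finite_subset) simp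
  have o_vert: "?o e \<in> verts G" if "e \<in> A" for e
    using that AE by (auto simp: other_end_def)
  have "(\<Sum>e\<in>arcs G - A. ?k e x) / mV x = (\<Sum>e\<in>arcs G. ?k e x) / mV x - (\<Sum>e\<in>A. ?k e x) / mV x" for x
    using sum_diff[OF finite_arcs AE, of "\<lambda>e. ?k e x"] by (simp only: diff_divide_distrib)
  then have "(\<Sum>x\<in>verts G - {v}. (\<Sum>e\<in>arcs G - A. ?k e x) / mV x) =
      (\<Sum>x\<in>verts G - {v}. (\<Sum>e\<in>arcs G. ?k e x) / mV x) - (\<Sum>x\<in>verts G - {v}. (\<Sum>e\<in>A. ?k e x) / mV x)"
    by (simp only: sum_subtractf)
  then have "(\<Sum>x\<in>verts G. (\<Sum>e\<in>arcs G - A. ?k e x) / mV x) - (\<Sum>x\<in>verts G - {v}. (\<Sum>e\<in>arcs G. ?k e x) / mV x)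
      = (\<Sum>e\<in>arcs G - A. ?k e v) / mV v - (\<Sum>x\<in>verts G - {v}. (\<Sum>e\<in>A. ?k e x) / mV x)"
    using sum.remove[OF finite_verts v, of "\<lambda>x. (\<Sum>e\<in>arcs G - A. ?k e x) / mV x"] by linarith
  also have "(\<Sum>x\<in>verts G - {v}. (\<Sum>e\<in>A. ?k e x) / mV x) =
      (\<Sum>e\<in>A. if ?o e = v then 0 else mE e / mV (?o e))"
  proof -
    have "(\<Sum>x\<in>verts G - {v}. (\<Sum>e\<in>A. ?k e x) / mV x) = (\<Sum>e\<in>A. \<Sum>x\<in>verts G - {v}. ?k e x / mV x)"
      by (simp add: sum_divide_distrib) (rule sum.swap)
    also have "\<dots> = (\<Sum>e\<in>A. if ?o e = v then 0 else mE e / mV (?o e))"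
    proof (intro sum.cong refl)
      fix e assume e: "e \<in> A"
      have "(\<Sum>x\<in>verts G - {v}. ?k e x / mV x) = (\<Sum>x\<in>verts G - {v}. if x = ?o e then mE e / mV x else 0)"
        using e A by (intro sum.cong refl) (auto simp: other_end_def split: if_splits)
      also have "\<dots> = (if ?o e = v then 0 else mE e / mV (?o e))"
        using o_vert[OF e] by simp
      finally show "(\<Sum>x\<in>verts G - {v}. ?k e x / mV x) = (if ?o e = v then 0 else mE e / mV (?o e))" .
    qed
    finally show ?thesis .
  qed
  also have "(\<Sum>e\<in>arcs G - A. ?k e v) = rel_weight G mV mE v * mV v - sum mE A - (\<Sum>e\<in>A. if ?o e = v then mE e else 0)"
  proof -
    \<comment> \<open>Without loops outside \<open>A\<close> the exclusive or is an ordinary sum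
      over the two ends, which \<open>sum_arcs_ends\<close> evaluates.\<close>
    have "(\<Sum>e\<in>arcs G - A. ?k e v) = (\<Sum>e\<in>arcs G - A. (of_bool (head G e = v) + of_bool (tail G e = v)) * mE e)"
    proof (intro sum.cong refl)
      fix e assume "e \<in> arcs G - A"
      from noloop[OF this] show "?k e v = (of_bool (head G e = v) + of_bool (tail G e = v)) * mE e"
        by auto
    qed
    also have "\<dots> = (\<Sum>e\<in>arcs G. (of_bool (head G e = v) + of_bool (tail G e = v)) * mE e) -
        (\<Sum>e\<in>A. (of_bool (head G e = v) + of_bool (tail G e = v)) * mE e)"
      using AE by (intro sum_diff) auto
    also have "(\<Sum>e\<in>arcs G. (of_bool (head G e = v) + of_bool (tail G e = v)) * mE e) = rel_weight G mV mE v * mV v"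
    proof -
      have "(\<Sum>x\<in>verts G. of_bool (x = v) * (rel_weight G mV mE x * mV x)) =
          (\<Sum>x\<in>verts G. if x = v then rel_weight G mV mE x * mV x else 0)"
        by (intro sum.cong) auto
      then show ?thesis
        using sum_arcs_ends[of "\<lambda>x. of_bool (x = v)"] v by simp
    qed
    also have "(\<Sum>e\<in>A. (of_bool (head G e = v) + of_bool (tail G e = v)) * mE e) =
        sum mE A + (\<Sum>e\<in>A. if ?o e = v then mE e else 0)"
      unfolding sum.distrib[symmetric]
      using A by (intro sum.cong refl) (auto simp: other_end_def)
    finally show ?thesis by simp
  qed
  also have "(rel_weight G mV mE v * mV v - sum mE A - (\<Sum>e\<in>A. if ?o e = v then mE e else 0)) / mV v =
      rel_weight G mV mE v - sum mE A / mV v - (\<Sum>e\<in>A. if ?o e = v then mE e / mV (?o e) else 0)"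
  proof -
    have "(\<Sum>e\<in>A. if ?o e = v then mE e else 0) / mV v = (\<Sum>e\<in>A. if ?o e = v then mE e / mV (?o e) else 0)"
      unfolding sum_divide_distrib by (intro sum.cong) auto
    then show ?thesis
      using mV_pos[OF v] by (simp add: diff_divide_distrib)
  qed
  moreover have "(\<Sum>e\<in>A. mE e / mV (?o e)) =
      (\<Sum>e\<in>A. if ?o e = v then mE e / mV (?o e) else 0) + (\<Sum>e\<in>A. if ?o e = v then 0 else mE e / mV (?o e))"
    unfolding sum.distrib[symmetric] by (intro sum.cong) auto
  ultimately show ?thesis by linarith
qed

end

theorem theorem4p4:
  fixes G :: "('v, 'e) pre_digraph" and mV :: "'v \<Rightarrow> real" and mE :: "'e \<Rightarrow> real"
    and v0 :: 'v and A :: "'e set" and \<delta> :: real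
  assumes "finite_weighted_graph G mV mE"
    and "centre_vertex_with G v0 A"
    and "\<delta> = rel_weight G mV mE v0
           - (\<Sum>e\<in>A. mE e / mV (other_end G v0 e)) - sum mE A / mV v0"
  shows "\<delta> \<le> measure lebesgue (magnetic_spectral_gaps G mV mE) \<and>
         (\<delta> > 0 \<longrightarrow> magnetic_spectral_gaps G mV mE \<noteq> {})"
proof -
  interpret finite_weighted_graph G mV mE by fact
  let ?V = "verts G" and ?Y = "verts G - {v0}" and ?F = "arcs G - A" and ?R = "2 * max_rel_weight G mV mE"
  let ?T = "magnetic_form ?F (\<lambda>_. 0)" and ?D = "magnetic_form (arcs G) (\<lambda>_. 0)"
  have v0: "v0 \<in> ?V" and A: "A \<subseteq> in_arcs G v0 \<union> out_arcs G v0"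
    and acyclic: "\<nexists>vs es. undirected_cycle (G\<lparr>arcs := ?F\<rparr>) vs es"
    using assms(2) by (simp_all add: centre_vertex_with_def undirected_tree_def)
  have pos: "\<forall>x\<in>?V. 0 < mV x" "\<forall>x\<in>?Y. 0 < mV x"
    using mV_pos by auto
  have finY: "finite ?Y" by simp
  obtain a \<mu> where T: "eigensystem ?V mV ?T (card ?V) a \<mu>"
    by (rule hermitian_eigensystem[OF finite_verts pos(1) hermitian_form_magnetic continuous_magnetic_form])
  obtain b \<nu> where D: "eigensystem ?Y mV ?D (card ?Y) b \<nu>"
    by (rule hermitian_eigensystem[OF finY pos(2) hermitian_form_magnetic continuous_magnetic_form])
  define S where "S = {0..?R} \<inter>
    (\<Union>\<alpha>. complex_of_real -` op_spectrum (ell2 ?V) (magnetic_laplacian G mV mE \<alpha>))"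
  have "compact S"
    unfolding S_def by (rule compact_magnetic_spectra)
  then have S: "S \<in> sets borel" by (simp add: borel_compact)

  have D_eq: "magnetic_form (arcs G) \<alpha> u u = ?D u u" if "\<And>e. e \<in> ?F \<Longrightarrow> \<alpha> e = 0" "u \<in> ell2 ?Y" for \<alpha> u
    using A that(1) by (rule magnetic_form_Dirichlet_eq) (use that(2) in \<open>auto simp: ell2_def\<close>)
  have T_le: "Re (?T u u) \<le> Re (magnetic_form (arcs G) \<alpha> u u)" if "\<And>e. e \<in> ?F \<Longrightarrow> \<alpha> e = 0" for \<alpha> u
    using that by (rule magnetic_form_tree_le[OF Diff_subset])
  \<comment> \<open>For arbitrary z no eigenvector is at hand; the zero potential serves as the
    intermediate form, and its restriction to functions vanishing at \<open>v0\<close> is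
    \<open>?D\<close> itself.\<close>
  have count_le: "card {j. j < card ?Y \<and> \<nu> j < z} \<le> card {i. i < card ?V \<and> \<mu> i \<le> z}" for z
    by (rule eigenvalue_bracketing(1)[where q = ?D, OF finite_verts pos(1) Diff_subset
      hermitian_form_magnetic hermitian_form_magnetic hermitian_form_magnetic T D])
      (use T_le[of "\<lambda>_. 0"] in auto)
  have count_less: "card {j. j < card ?Y \<and> \<nu> j < z} < card {i. i < card ?V \<and> \<mu> i \<le> z}" if "z \<in> S" for z
  proof -
    obtain \<alpha> where "complex_of_real z \<in> op_spectrum (ell2 ?V) (magnetic_laplacian G mV mE \<alpha>)"
      using \<open>z \<in> S\<close> by (auto simp: S_def)
    then have ev: "\<exists>f\<in>ell2 ?V. f \<noteq> (\<lambda>_. 0) \<and> magnetic_laplacian G mV mE \<alpha> f = (\<lambda>x. complex_of_real z * f x)"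
      by (simp only: magnetic_laplacian_spectrum_iff)
    obtain \<theta> where \<theta>: "\<And>e. e \<in> ?F \<Longrightarrow> \<theta> (tail G e) - \<theta> (head G e) = \<alpha> e"
      using acyclic_potential[OF _ acyclic, of \<alpha>] by auto
    define \<alpha>' where "\<alpha>' e = \<alpha> e + \<theta> (head G e) - \<theta> (tail G e)" for e
    have \<alpha>': "\<alpha>' e = 0" if "e \<in> ?F" for e
      using \<theta>[OF that] by (simp add: \<alpha>'_def)
    obtain f where f: "f \<in> ell2 ?V" "f \<noteq> (\<lambda>_. 0)"
      and eig: "\<And>g. g \<in> ell2 ?V \<Longrightarrow> magnetic_form (arcs G) \<alpha>' g f = complex_of_real z * ell2_inner ?V mV g f"
      using magnetic_eigenvector_gauge[OF ev, of \<theta>] unfolding \<alpha>'_def by blast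
    have "Suc (card {j. j < card ?Y \<and> \<nu> j < z}) \<le> card {i. i < card ?V \<and> \<mu> i \<le> z}"
      by (rule eigenvalue_bracketing(2)[where q = "magnetic_form (arcs G) \<alpha>'", OF finite_verts pos(1) Diff_subset
        hermitian_form_magnetic hermitian_form_magnetic hermitian_form_magnetic T D T_le D_eq f eig])
        (use \<alpha>' in auto)
    then show ?thesis by simp
  qed

  have \<mu>: "\<mu> i \<le> ?R" if "i < card ?V" for i
    using eigensystem_Rayleigh[OF T that] magnetic_form_le[of ?F "\<lambda>_. 0" "a i"] by simp
  have \<nu>: "0 \<le> \<nu> j" if "j < card ?Y" for j
    using eigensystem_Rayleigh(1)[OF D that] magnetic_form_nonneg[of "arcs G" "\<lambda>_. 0" "b j"] by simp
  have "measure lborel S \<le> (\<Sum>i<card ?V. ?R - \<mu> i) - (\<Sum>j<card ?Y. ?R - \<nu> j)"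
    by (rule measure_le_of_counts[OF S _ \<mu> \<nu> count_le count_less]) (auto simp: S_def)
  also have "\<dots> = ?R - ((\<Sum>i<card ?V. \<mu> i) - (\<Sum>j<card ?Y. \<nu> j))"
  proof -
    have "card ?V = Suc (card ?Y)"
      using v0 by (rule card.remove[OF finite_verts])
    then show ?thesis by (simp only: sum_subtractf sum_constant card_lessThan of_nat_Suc) (simp add: algebra_simps)
  qed
  also have "(\<Sum>i<card ?V. \<mu> i) - (\<Sum>j<card ?Y. \<nu> j) = \<delta>"
    unfolding eigensystem_trace[OF finite_verts pos(1) hermitian_form_magnetic T]
      eigensystem_trace[OF finY pos(2) hermitian_form_magnetic D]
      magnetic_form_delta[OF Diff_subset] magnetic_form_delta[OF subset_refl] assms(3)
    by (rule trace_difference[OF v0 A]) (rule acyclic_no_loop[OF acyclic])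
  finally have S_le: "measure lborel S \<le> ?R - \<delta>" .

  \<comment> \<open>The interval from 0 to \<open>?R\<close> has measure \<open>?R\<close> only if
    \<open>?R\<close> is nonnegative.\<close>
  have "0 \<le> rel_weight G mV mE v0"
    using mE_pos mV_pos[OF v0]
    by (auto simp: rel_weight_def less_imp_le intro!: divide_nonneg_pos add_nonneg_nonneg sum_nonneg)
  then have "?R \<ge> 0"
    using rel_weight_le_max[OF v0] by simp
  have gaps: "magnetic_spectral_gaps G mV mE = {0..?R} - S"
    by (auto simp: magnetic_spectral_gaps_def S_def)
  have "measure lebesgue ({0..?R} - S) = measure lborel ({0..?R} - S)"
    using S by (intro measure_completion) auto
  also have "\<dots> = measure lborel {0..?R} - measure lborel S"
    using S by (intro measure_Diff) (auto simp: S_def emeasure_lborel_Icc_eq)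
  finally have "\<delta> \<le> measure lebesgue (magnetic_spectral_gaps G mV mE)"
    using S_le \<open>?R \<ge> 0\<close> by (simp add: gaps)
  then show ?thesis by auto
qed

end
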